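(* Given $(A,B,C)\in\mathbb{Z}_{\geq 0}^3$ satisfying $AC\leq B^2$, there exist planar tropical curves $V_f$ and $V_g$ such that the intersection number of $V_f$ and $V_g$ and their self-intersection numbers are $(V_f,V_f)=A$, $(V_f,V_g)=B$, and $(V_g,V_g)=C$. (Here the assertion $(V_f,V_g)=B$ includes that $V_f$ and $V_g$ intersect transversally, so that $(V_f,V_g)$ is defined.)
   Context: A tropical bivariate polynomial is a function $f:\mathbb{R}^2\to\mathbb{R}$, $f(x,y)=\min\{c_{a,b}+ax+by : (a,b)\in S\}$, where $S\subset\mathbb{Z}^2$ is a finite non-empty set (the support of $f$) and $c_{a,b}\in\mathbb{R}$. The convex hull $P_f=\operatorname{conv} S$ is the Newton polytope of $f$. The planar tropical curve $V_f\subset\mathbb{R}^2$ is the set of points where the minimum in the definition of $f$ is attained at least twice (equivalently, where $f$ is not differentiable). It is a polyhedral complex of pure dimension 1 (possibly empty), dual to the regular subdivision $\mathcal{R}_f$ of $P_f$ induced by lifting each $(a,b)\in S$ to height $c_{a,b}$: vertices of $V_f$ correspond to 2-dimensional cells of $\mathcal{R}_f$, and edges (1-dimensional cells) $e$ of $V_f$ correspond to edges of $\mathcal{R}_f$. The edge of $\mathcal{R}_f$ dual to $e$ is the convex hull of those $(a,b)\in S$ attaining the minimum on the relative interior of $e$. The weight $w(e)$ is the lattice length of that dual edge, where the lattice length of a lattice segment $I$ is $|I\cap\mathbb{Z}^2|-1$. Two tropical curves $V_f,V_g$ intersect transversally if $V_f\cap V_g$ is finite and every $p\in V_f\cap V_g$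 lies in the relative interior of some edge $e$ of $V_f$ and of some edge $h$ of $V_g$. In that case the local intersection number at $p$ is $(V_f,V_g)_p=w(e)w(h)|\det(u,v)|$, where $u,v\in\mathbb{Z}^2$ are primitive vectors (coordinates relatively prime) parallel to $e$ and $h$ respectively, and the intersection number is $(V_f,V_g)=\sum_{p\in V_f\cap V_g}(V_f,V_g)_p$. The self-intersection number of $V_f$ is $(V_f,V_f):=(V_f,V_{f'})$, where $f'(x,y)=f(x+x_0,y+y_0)$ and $(x_0,y_0)\in\mathbb{R}^2$ is such that $V_f$ and its translate $V_{f'}$ intersect transversally. This holds for almost all $(x_0,y_0)$, and the resulting number does not depend on the choice of such $(x_0,y_0)$. *)

theory Defs
  imports "HOL-Analysis.Analysis"
begin

definition ivec :: "int \<times> int \<Rightarrow> real \<times> real" where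
  "ivec z = (real_of_int (fst z), real_of_int (snd z))"

definition primitive :: "int \<times> int \<Rightarrow> bool" where
  "primitive u \<longleftrightarrow> coprime (fst u) (snd u)"

definition det2 :: "int \<times> int \<Rightarrow> int \<times> int \<Rightarrow> int" where
  "det2 u v = fst u * snd v - snd u * fst v"

definition lattice_length :: "(real \<times> real) set \<Rightarrow> nat" where
  "lattice_length I = card {z. ivec z \<in> I} - 1"

(* The coefficients outside the support are irrelevant. *)
record trop_poly =
  supp :: "(int \<times> int) set"
  coef :: "int \<times> int \<Rightarrow> real"

definition is_trop_poly :: "trop_poly \<Rightarrow> bool" where
  "is_trop_poly f \<longleftrightarrow> finite (supp f) \<and> supp f \<noteq> {}"

definition trop_term :: "trop_poly \<Rightarrow> int \<times> int \<Rightarrow> real \<times> real \<Rightarrow> real" where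
  "trop_term f s p = coef f s + ivec s \<bullet> p"

definition trop_eval :: "trop_poly \<Rightarrow> real \<times> real \<Rightarrow> real" where
  "trop_eval f p = Min ((\<lambda>s. trop_term f s p) ` supp f)"

definition minimizers :: "trop_poly \<Rightarrow> real \<times> real \<Rightarrow> (int \<times> int) set" where
  "minimizers f p = {s \<in> supp f. trop_term f s p = trop_eval f p}"

definition trop_curve :: "trop_poly \<Rightarrow> (real \<times> real) set" where
  "trop_curve f = {p. card (minimizers f p) \<ge> 2}"

(* The polygons conv (minimizers f p) are the cells of the regular subdivision
   induced by f. The closed cell dual to such a polygon consists of all points at
   which every element of minimizers f p is again a minimizer; it is the cell that
   contains p in its relative interior. *)
definition dual_cell :: "trop_poly \<Rightarrow> real \<times> real \<Rightarrow> (real \<times> real) set" where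
  "dual_cell f p = {q. minimizers f p \<subseteq> minimizers f q}"

definition trop_cells :: "trop_poly \<Rightarrow> (real \<times> real) set set" where
  "trop_cells f = dual_cell f ` trop_curve f"

definition trop_edges :: "trop_poly \<Rightarrow> (real \<times> real) set set" where
  "trop_edges f = {e \<in> trop_cells f. aff_dim e = 1}"

definition dual_edge :: "trop_poly \<Rightarrow> (real \<times> real) set \<Rightarrow> (real \<times> real) set" where
  "dual_edge f e = convex hull (ivec ` {s \<in> supp f. \<forall>q \<in> rel_interior e. s \<in> minimizers f q})"

definition edge_weight :: "trop_poly \<Rightarrow> (real \<times> real) set \<Rightarrow> nat" where
  "edge_weight f e = lattice_length (dual_edge f e)"

definition transversal :: "trop_poly \<Rightarrow> trop_poly \<Rightarrow> bool" where
  "transversal f g \<longleftrightarrow>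
     finite (trop_curve f \<inter> trop_curve g) \<and>
     (\<forall>p \<in> trop_curve f \<inter> trop_curve g.
        (\<exists>e \<in> trop_edges f. p \<in> rel_interior e) \<and>
        (\<exists>h \<in> trop_edges g. p \<in> rel_interior h))"

definition edge_through :: "trop_poly \<Rightarrow> real \<times> real \<Rightarrow> (real \<times> real) set" where
  "edge_through f p = (THE e. e \<in> trop_edges f \<and> p \<in> rel_interior e)"

(* Determined up to sign, which the absolute value in local_intersection ignores. *)
definition primitive_direction :: "(real \<times> real) set \<Rightarrow> int \<times> int" where
  "primitive_direction e =
     (SOME u. primitive u \<and> affine_parallel (span {ivec u}) (affine hull e))"

definition local_intersection :: "trop_poly \<Rightarrow> trop_poly \<Rightarrow> real \<times> real \<Rightarrow> nat" where
  "local_intersection f g p =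
     (let e = edge_through f p; h = edge_through g p
      in edge_weight f e * edge_weight g h *
         nat \<bar>det2 (primitive_direction e) (primitive_direction h)\<bar>)"

(* Meaningful only if transversal f g holds. *)
definition intersection_number :: "trop_poly \<Rightarrow> trop_poly \<Rightarrow> nat" where
  "intersection_number f g = (\<Sum>p \<in> trop_curve f \<inter> trop_curve g. local_intersection f g p)"

definition translate :: "real \<times> real \<Rightarrow> trop_poly \<Rightarrow> trop_poly" where
  "translate v f = \<lparr>supp = supp f, coef = (\<lambda>s. coef f s + ivec s \<bullet> v)\<rparr>"

lemma trop_eval_translate: "trop_eval (translate v f) p = trop_eval f (p + v)"
  by (simp add: trop_eval_def trop_term_def translate_def inner_add_right add_ac)

(* The self-intersection number of f is n: f has a transversal translate, and every
   transversal translate yields n, so that n does not depend on the choice. *)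
definition has_self_intersection_number :: "trop_poly \<Rightarrow> nat \<Rightarrow> bool" where
  "has_self_intersection_number f n \<longleftrightarrow>
     (\<exists>v. transversal f (translate v f)) \<and>
     (\<forall>v. transversal f (translate v f) \<longrightarrow> intersection_number f (translate v f) = n)"

end

theory Submission
  imports Defs
begin

text \<open>
  If all coefficients of \<open>g\<close> are linear in the exponent, then the curve of \<open>g\<close> is a fan, dual to the
  edges of a polygon \<open>T\<close>. Along a ray \<open>c + t u\<close> of this fan, the local intersection numbers with
  the curve of \<open>f\<close> are, up to the weight of the ray, the drops in slope of the concave function
  \<open>f\<close>, so they add up to the difference of its slopes at the two ends. Since the fan is balanced,
  the contributions of the slopes at \<open>c\<close> cancel, and the intersection number depends only on
  \<open>T\<close> and the support \<open>S\<close> of \<open>f\<close>: it is the mixed volume, which is symmetric and additive under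
  Minkowski sums.

  It remains to find polygons with \<open>(S,S) = A\<close>, \<open>(S,T) = B\<close>, \<open>(T,T) = C\<close>. We may assume
  \<open>A \<le> C\<close>, so that \<open>A \<le> B\<close>. Replacing \<open>T\<close> by \<open>S + T\<close> turns the triple
  \<open>(A, B - A, C - 2B + A)\<close> into \<open>(A, B, C)\<close> and does not change \<open>B\<^sup>2 - AC\<close>, so one can
  descend as long as \<open>A + C > 2B\<close>. When \<open>A + C \<le> 2B\<close>, a triangle and a trapezoid of lattice height
  one do the job.
\<close>

subsection \<open>Lattice vectors and lattice length\<close>

definition idot :: "int \<times> int \<Rightarrow> int \<times> int \<Rightarrow> int" where
  "idot s u = fst s * fst u + snd s * snd u"

lemma ivec_inner_ivec: "ivec s \<bullet> ivec u = of_int (idot s u)"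
  by (simp add: ivec_def idot_def inner_prod_def)

lemma idot_commute: "idot s u = idot u s"
  by (simp add: idot_def mult.commute)

lemma ivec_diff: "ivec (s - t) = ivec s - ivec t"
  by (simp add: ivec_def)

lemma ivec_add: "ivec (s + t) = ivec s + ivec t"
  by (simp add: ivec_def)

lemma idot_add_left: "idot (s + t) u = idot s u + idot t u"
  by (simp add: idot_def algebra_simps)

lemma idot_diff_left: "idot (s - t) u = idot s u - idot t u"
  by (simp add: idot_def algebra_simps)

lemma primitive_nonzero: "primitive u \<Longrightarrow> ivec u \<noteq> 0"
  by (auto simp: primitive_def ivec_def prod_eq_iff)

lemma det2_commute: "\<bar>det2 u v\<bar> = \<bar>det2 v u\<bar>"
  by (simp add: det2_def abs_minus_commute mult.commute)

text \<open>Coprimality of the coordinates of \<open>u\<close> forces \<open>fst u\<close> to divide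
  \<open>snd z\<close> and \<open>snd u\<close> to divide \<open>fst z\<close>; the two quotients
  agree up to sign, so \<open>z\<close> is an integer multiple of the quarter turn of
  \<open>u\<close>.\<close>

lemma orthogonal_primitive:
  assumes "primitive u" "idot z u = 0"
  obtains k where "z = (- k * snd u, k * fst u)"
proof -
  have eq: "fst z * fst u = - (snd z * snd u)"
    using assms(2) by (simp add: idot_def)
  have cop: "coprime (fst u) (snd u)"
    using assms(1) by (simp add: primitive_def)
  have "fst u dvd snd z * snd u"
    by (metis dvd_minus_iff dvd_triv_right eq)
  then have "fst u dvd snd z"
    using cop coprime_dvd_mult_left_iff by blast
  then obtain k where k: "snd z = k * fst u"
    by (metis dvdE mult.commute)
  have "snd u dvd fst z * fst u"
    by (metis dvd_minus_iff dvd_triv_right eq)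
  then have "snd u dvd fst z"
    using cop coprime_commute coprime_dvd_mult_left_iff by blast
  then obtain l where l: "fst z = l * snd u"
    by (metis dvdE mult.commute)
  \<comment> \<open>If \<open>fst u = 0\<close>, the equation \<open>snd z = k * fst u\<close> does
    not determine \<open>k\<close>, so the multiplier is taken from the other coordinate.\<close>
  show thesis
  proof (cases "fst u = 0")
    case True
    then have "snd u \<noteq> 0" using cop by auto
    then have "snd z = 0" using k True by auto
    moreover have "fst z = - (- l) * snd u" using l by simp
    ultimately show thesis using that[of "- l"] True by (simp add: prod_eq_iff)
  next
    case False
    have "l * snd u * fst u = - (k * fst u * snd u)" using eq k l by simp
    then have "fst u * (l * snd u + k * snd u) = 0" by (simp add: algebra_simps)
    then have "l * snd u = - k * snd u" using False by auto
    then show thesis using that[of k] k l by (simp add: prod_eq_iff)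
  qed
qed

text \<open>By \<open>orthogonal_primitive\<close>, applied to the quarter turn of \<open>v\<close>,
  the vector \<open>v\<close> is \<open>k\<close> times \<open>u\<close>; as a common factor of the
  coordinates of \<open>v\<close>, \<open>k\<close> is a unit.\<close>

lemma primitive_parallel:
  assumes "primitive u" "primitive v" "det2 u v = 0"
  shows "v = u \<or> v = - u"
proof -
  have "idot (- snd v, fst v) u = 0" using assms(3) by (simp add: idot_def det2_def mult.commute)
  then obtain k where "(- snd v, fst v) = (- k * snd u, k * fst u)"
    using orthogonal_primitive[OF assms(1)] by blast
  then have v: "fst v = k * fst u" "snd v = k * snd u" by auto
  then have "is_unit k"
    using assms(2) unfolding primitive_def by (metis coprime_common_divisor dvd_triv_left)
  then have "k = 1 \<or> k = -1" by (simp add: zdvd1_eq) linarith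
  with v show ?thesis by (auto simp: prod_eq_iff)
qed

lemma obtain_primitive:
  assumes "z \<noteq> (0 :: int \<times> int)"
  obtains u where "primitive u" "idot z u = 0"
proof -
  obtain a b where z: "z = (a, b)" by fastforce
  define g where "g = gcd a b"
  have "g \<noteq> 0" using assms z by (auto simp: g_def zero_prod_def)
  then obtain a' b' where ab: "a = a' * g" "b = b' * g" "coprime a' b'"
    unfolding g_def using gcd_coprime_exists by blast
  have "primitive (- b', a')" using ab(3) by (simp add: primitive_def coprime_commute)
  moreover have "idot z (- b', a') = 0" by (simp add: idot_def z ab)
  ultimately show thesis using that by blast
qed

section \<open>Faces, normals and weights of finite point sets\<close>

definition face :: "(int \<times> int) set \<Rightarrow> real \<times> real \<Rightarrow> (int \<times> int) set" where
  "face S d = {s \<in> S. \<forall>s'\<in>S. ivec s \<bullet> d \<le> ivec s' \<bullet> d}"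

text \<open>If \<open>m\<close> has two or more points, they lie on a line with normal
  \<open>u\<close>. For a set of minimizers, \<open>u\<close> is then the direction of the dual edge
  of the curve.\<close>

definition orth :: "(int \<times> int) set \<Rightarrow> int \<times> int \<Rightarrow> bool" where
  "orth m u \<longleftrightarrow> primitive u \<and> (\<forall>s\<in>m. \<forall>s'\<in>m. idot s u = idot s' u)"

text \<open>For the minimizers at a point of a line with direction \<open>d\<close>, this is the
  drop in slope of the tropical polynomial along the line at that point.\<close>

definition width :: "(int \<times> int) set \<Rightarrow> int \<times> int \<Rightarrow> int" where
  "width m d = Max ((\<lambda>s. idot s d) ` m) - Min ((\<lambda>s. idot s d) ` m)"

definition wt :: "(int \<times> int) set \<Rightarrow> nat" where
  "wt m = lattice_length (convex hull (ivec ` m))"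

lemma orthD: "orth m u \<Longrightarrow> s \<in> m \<Longrightarrow> s' \<in> m \<Longrightarrow> idot s u = idot s' u"
  unfolding orth_def by blast

lemma obtain_two:
  assumes "card m \<ge> 2"
  obtains s s' where "s \<in> m" "s' \<in> m" "s \<noteq> s'"
proof -
  obtain m' where "m' \<subseteq> m" "card m' = 2" using ex_card[OF assms] by blast
  then show thesis using that unfolding card_2_iff by blast
qed

lemma orth_unique:
  assumes "orth m u" "orth m v" "card m \<ge> 2"
  shows "v = u \<or> v = - u"
proof -
  obtain s s' where s: "s \<in> m" "s' \<in> m" "s \<noteq> s'"
    using obtain_two[OF assms(3)] by blast
  have "idot (s - s') u = 0" "idot (s - s') v = 0"
    using orthD[OF assms(1) s(1,2)] orthD[OF assms(2) s(1,2)] by (simp_all add: idot_diff_left)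
  moreover have pu: "primitive u" "primitive v" using assms by (auto simp: orth_def)
  ultimately obtain k where k: "s - s' = (- k * snd u, k * fst u)"
    using orthogonal_primitive by blast
  have "k \<noteq> 0" using k s(3) by (auto simp: prod_eq_iff)
  moreover have "k * det2 u v = 0"
    using \<open>idot (s - s') v = 0\<close> unfolding k by (simp add: idot_def det2_def algebra_simps)
  ultimately show ?thesis using primitive_parallel[OF pu] by simp
qed

text \<open>The set \<open>m\<close> lies on a lattice line whose consecutive points differ by the
  quarter turn of \<open>u\<close>. The weight counts the steps between the extreme points of
  \<open>m\<close>, and each step changes \<open>idot _ d\<close> by \<open>det2 u d\<close>. This
  turns the determinant of a local intersection number into a difference of slopes.\<close>

lemma wt_mult_det2:
  assumes "finite m" "m \<noteq> {}" "orth m u"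
  shows "int (wt m) * \<bar>det2 u d\<bar> = width m d"
proof -
  have pu: "primitive u" using assms(3) by (simp add: orth_def)
  obtain s0 where s0: "s0 \<in> m" using assms(2) by blast
  \<comment> \<open>\<open>r\<close> enumerates the lattice points on the line through
    \<open>s0\<close> with normal \<open>u\<close>.\<close>
  define r where "r k = s0 + (- k * snd u, k * fst u)" for k
  have u0: "fst u \<noteq> 0 \<or> snd u \<noteq> 0" using pu by (auto simp: primitive_def)
  have inj: "inj r" using u0 by (auto simp: inj_def r_def)
  have idr: "idot (r k) d = idot s0 d + k * det2 u d" for k d
    by (simp add: r_def idot_def det2_def algebra_simps)
  have orth_r: "\<exists>k. z = r k" if "idot z u = idot s0 u" for z
  proof -
    have "idot (z - s0) u = 0" using that by (simp add: idot_diff_left)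
    then obtain k where "z - s0 = (- k * snd u, k * fst u)"
      using orthogonal_primitive[OF pu] by blast
    then have "z = r k" by (metis r_def add.commute diff_add_cancel)
    then show ?thesis by blast
  qed
  define K where "K = {k. r k \<in> m}"
  have m_eq: "m = r ` K"
    using orth_r assms(3) s0 unfolding K_def orth_def by blast
  have fK: "finite K" using assms(1) inj m_eq finite_imageD inj_on_subset by blast
  have Kne: "K \<noteq> {}" using m_eq assms(2) by blast
  define a b where "a = Min K" and "b = Max K"
  have ab: "a \<in> K" "b \<in> K" "\<And>k. k \<in> K \<Longrightarrow> a \<le> k \<and> k \<le> b"
    using fK Kne by (auto simp: a_def b_def)
  then have "a \<le> b" by blast
  define n where "n = (- real_of_int (snd u), real_of_int (fst u))"
  have ivr: "ivec (r k) = ivec s0 + real_of_int k *\<^sub>R n" for k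
    by (simp add: r_def ivec_add) (simp add: ivec_def n_def)
  have n_pos: "n \<bullet> n > 0" using u0 by (auto simp: n_def inner_prod_def add_nonneg_eq_0_iff
      less_le inner_real_def)
  have n_u: "n \<bullet> ivec u = 0" by (simp add: n_def ivec_def inner_prod_def)
  \<comment> \<open>The hull lies on the line and between the two halfspaces bounding the positions
    \<open>a\<close> and \<open>b\<close>; conversely it contains the segment from
    \<open>r a\<close> to \<open>r b\<close>.\<close>
  have pts: "{z. ivec z \<in> convex hull (ivec ` m)} = r ` {a..b}"
  proof (intro set_eqI iffI)
    fix z assume "z \<in> {z. ivec z \<in> convex hull (ivec ` m)}"
    moreover have "convex hull (ivec ` m) \<subseteq>
        {x. ivec u \<bullet> x = real_of_int (idot s0 u)} \<inter>
        ({x. n \<bullet> x \<ge> n \<bullet> ivec s0 + a * (n \<bullet> n)} \<inter> {x. n \<bullet> x \<le> n \<bullet> ivec s0 + b * (n \<bullet> n)})"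
    proof (rule hull_minimal)
      show "convex ({x. ivec u \<bullet> x = real_of_int (idot s0 u)} \<inter>
        ({x. n \<bullet> x \<ge> n \<bullet> ivec s0 + a * (n \<bullet> n)} \<inter> {x. n \<bullet> x \<le> n \<bullet> ivec s0 + b * (n \<bullet> n)}))"
        by (intro convex_Int convex_hyperplane convex_halfspace_ge convex_halfspace_le)
      show "ivec ` m \<subseteq> {x. ivec u \<bullet> x = real_of_int (idot s0 u)} \<inter>
        ({x. n \<bullet> x \<ge> n \<bullet> ivec s0 + a * (n \<bullet> n)} \<inter> {x. n \<bullet> x \<le> n \<bullet> ivec s0 + b * (n \<bullet> n)})"
      proof
        fix x assume "x \<in> ivec ` m"
        then obtain k where k: "k \<in> K" "r k \<in> m" "x = ivec (r k)" using m_eq by blast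
        have "ivec u \<bullet> x = real_of_int (idot (r k) u)"
          by (simp add: k ivec_inner_ivec idot_def mult.commute)
        moreover have "n \<bullet> x = n \<bullet> ivec s0 + k * (n \<bullet> n)"
          by (simp add: k ivr inner_add_right)
        moreover have "real_of_int a * (n \<bullet> n) \<le> k * (n \<bullet> n)" "k * (n \<bullet> n) \<le> b * (n \<bullet> n)"
          using ab(3)[OF k(1)] n_pos by (auto intro!: mult_right_mono)
        ultimately show "x \<in> {x. ivec u \<bullet> x = real_of_int (idot s0 u)} \<inter>
          ({x. n \<bullet> x \<ge> n \<bullet> ivec s0 + a * (n \<bullet> n)} \<inter> {x. n \<bullet> x \<le> n \<bullet> ivec s0 + b * (n \<bullet> n)})"
          using orthD[OF assms(3) k(2) s0] by simp
      qed
    qed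
    ultimately have z: "ivec u \<bullet> ivec z = real_of_int (idot s0 u)"
      "n \<bullet> ivec z \<ge> n \<bullet> ivec s0 + a * (n \<bullet> n)" "n \<bullet> ivec z \<le> n \<bullet> ivec s0 + b * (n \<bullet> n)"
      by auto
    from z(1) have "idot z u = idot s0 u"
      by (simp add: ivec_inner_ivec idot_commute[of z])
    then obtain k where k: "z = r k" using orth_r by blast
    have "n \<bullet> ivec z = n \<bullet> ivec s0 + k * (n \<bullet> n)" by (simp add: k ivr inner_add_right)
    then have "k \<in> {a..b}" using z(2,3) n_pos by simp
    then show "z \<in> r ` {a..b}" using k by blast
  next
    fix z assume "z \<in> r ` {a..b}"
    then obtain k where k: "z = r k" "a \<le> k" "k \<le> b" by auto
    have "ivec z \<in> closed_segment (ivec (r a)) (ivec (r b))"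
    proof (cases "a = b")
      case True then show ?thesis using k by simp
    next
      case False
      define t where "t = real_of_int (k - a) / real_of_int (b - a)"
      have ba: "real_of_int (b - a) > 0" using False \<open>a \<le> b\<close> by simp
      have "0 \<le> t" "t \<le> 1" using k ba by (auto simp: t_def)
      have "(1 - t) * a + t * b = k"
      proof -
        have "t * (real_of_int b - real_of_int a) = real_of_int k - real_of_int a"
          using ba by (simp add: t_def)
        then show ?thesis by (simp add: algebra_simps)
      qed
      moreover have "(1 - t) *\<^sub>R ivec (r a) + t *\<^sub>R ivec (r b) =
          ivec s0 + ((1 - t) * a + t * b) *\<^sub>R n"
        unfolding ivr by (simp add: algebra_simps)
      ultimately have "ivec z = (1 - t) *\<^sub>R ivec (r a) + t *\<^sub>R ivec (r b)"
        unfolding k(1) ivr by simp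
      with \<open>0 \<le> t\<close> \<open>t \<le> 1\<close> show ?thesis by (auto simp: closed_segment_def)
    qed
    also have "\<dots> \<subseteq> convex hull (ivec ` m)"
      using ab(1,2) by (intro closed_segment_subset) (auto simp: m_eq hull_inc)
    finally show "z \<in> {z. ivec z \<in> convex hull (ivec ` m)}" by simp
  qed
  have "card (r ` {a..b}) = nat (b - a + 1)"
    using inj by (subst card_image) (auto intro: inj_on_subset)
  then have wt: "int (wt m) = b - a"
    using \<open>a \<le> b\<close> by (simp add: wt_def lattice_length_def pts)
  have im: "(\<lambda>s. idot s d) ` m = (\<lambda>k. idot s0 d + k * det2 u d) ` K"
    by (simp add: m_eq image_image idr)
  show ?thesis
  proof (cases "det2 u d \<ge> 0")
    case True
    have "Max ((\<lambda>s. idot s d) ` m) = idot s0 d + b * det2 u d"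
      unfolding im using ab True fK by (intro Max_eqI) (auto intro!: mult_right_mono)
    moreover have "Min ((\<lambda>s. idot s d) ` m) = idot s0 d + a * det2 u d"
      unfolding im using ab True fK by (intro Min_eqI) (auto intro!: mult_right_mono)
    ultimately show ?thesis using True by (simp add: width_def wt algebra_simps)
  next
    case False
    have "Max ((\<lambda>s. idot s d) ` m) = idot s0 d + a * det2 u d"
      unfolding im using ab False fK by (intro Max_eqI) (auto intro!: mult_right_mono_neg)
    moreover have "Min ((\<lambda>s. idot s d) ` m) = idot s0 d + b * det2 u d"
      unfolding im using ab False fK by (intro Min_eqI) (auto intro!: mult_right_mono_neg)
    ultimately show ?thesis using False by (simp add: width_def wt algebra_simps)
  qed
qed

subsection \<open>Slopes of a lower envelope\<close>

text \<open>The minimum of the lines \<open>a s + t * b s\<close> is concave in \<open>t\<close>.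
  Its slope just after \<open>t0\<close> is the least slope among the minimizers at
  \<open>t0\<close>, its final slope is the least of all, and at each breakpoint it drops from the
  largest to the smallest slope attained there, so the drops telescope. Points of \<open>D\<close>
  that are no breakpoints contribute 0. The induction is on the slope still to be lost.\<close>

lemma envelope_jumps:
  fixes a :: "'a \<Rightarrow> real" and b :: "'a \<Rightarrow> int" and t0 :: real
  defines "m \<equiv> \<lambda>S (t :: real). {s \<in> S. \<forall>s'\<in>S. a s + t * b s \<le> a s' + t * b s'}"
  assumes "finite S" "s \<in> m S t0" "\<And>s'. s' \<in> m S t0 \<Longrightarrow> b s \<le> b s'"
    and "finite D" "D \<subseteq> {t0<..}"
    and "\<And>t s s'. t > t0 \<Longrightarrow> s \<in> m S t \<Longrightarrow> s' \<in> m S t \<Longrightarrow> b s \<noteq> b s' \<Longrightarrow> t \<in> D"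
  shows "(\<Sum>t\<in>D. Max (b ` m S t) - Min (b ` m S t)) = b s - Min (b ` S)"
  using assms(3-)
proof (induction "nat (b s - Min (b ` S))" arbitrary: s t0 D rule: less_induct)
  case less
  note fS = \<open>finite S\<close>
  have sS: "s \<in> S" using less.prems(1) by (simp add: m_def)
  have mono: "b s' \<le> b s" if "t > t0" "s' \<in> m S t" for t s'
  proof -
    have "a s + t0 * b s \<le> a s' + t0 * b s'" "a s' + t * b s' \<le> a s + t * b s"
      using less.prems(1) that(2) sS by (auto simp: m_def)
    then have "(t - t0) * (real_of_int (b s') - b s) \<le> 0" by (simp add: algebra_simps)
    then show ?thesis using that(1) by (simp add: mult_le_0_iff)
  qed
  have fin_m: "finite (m S t)" for t using fS by (simp add: m_def)
  have jump0: "Max (b ` m S t) - Min (b ` m S t) = 0" if "m S t \<noteq> {}" "\<And>s'. s' \<in> m S t \<Longrightarrow> b s' = c" for t c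
  proof -
    have "b ` m S t = {c}" using that by auto
    then show ?thesis by simp
  qed
  have m_ne: "m S t \<noteq> {}" for t
  proof -
    obtain x where "x \<in> S" "\<forall>y\<in>S. a x + t * b x \<le> a y + t * b y"
      using fS sS ex_min_if_finite[of "(\<lambda>x. a x + t * b x) ` S"] by (force simp: not_less)
    then show ?thesis by (auto simp: m_def)
  qed
  \<comment> \<open>Only the lines of smaller slope can undercut the line of \<open>s\<close> to the
    right of \<open>t0\<close>; if there are none, no breakpoint is left.\<close>
  define L where "L = {s' \<in> S. b s' < b s}"
  show ?case
  proof (cases "L = {}")
    case True
    then have le: "b s \<le> b s'" if "s' \<in> S" for s' using that by (force simp: L_def)
    then have "Min (b ` S) = b s" using sS fS by (intro Min_eqI) auto
    moreover have "Max (b ` m S t) - Min (b ` m S t) = 0" if "t \<in> D" for t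
    proof (rule jump0[OF m_ne])
      fix s' assume s': "s' \<in> m S t"
      have "t > t0" using that less.prems by auto
      from mono[OF this s'] le[of s'] s' show "b s' = b s" by (simp add: m_def)
    qed
    ultimately show ?thesis by simp
  next
    case False
    \<comment> \<open>\<open>\<tau> s'\<close> is the parameter at which the line of
      \<open>s'\<close> meets that of \<open>s\<close>. The first such crossing \<open>t1\<close> is
      the next breakpoint.\<close>
    define \<tau> where "\<tau> s' = (a s' - a s) / (b s - b s')" for s'
    have tau_le: "t \<le> \<tau> s' \<longleftrightarrow> a s + t * b s \<le> a s' + t * b s'"
      and tau_less: "t < \<tau> s' \<longleftrightarrow> a s + t * b s < a s' + t * b s'" if "s' \<in> L" for t s'
    proof -
      have "real_of_int (b s - b s') > 0" using that by (simp add: L_def)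
      then show "t \<le> \<tau> s' \<longleftrightarrow> a s + t * b s \<le> a s' + t * b s'"
        and "t < \<tau> s' \<longleftrightarrow> a s + t * b s < a s' + t * b s'"
        by (auto simp: \<tau>_def field_simps)
    qed
    have fL: "finite L" using fS by (simp add: L_def)
    define t1 where "t1 = Min (\<tau> ` L)"
    have t1_le: "t1 \<le> \<tau> s'" if "s' \<in> L" for s' using that fL by (simp add: t1_def)
    have "t1 \<in> \<tau> ` L" unfolding t1_def using fL False by (intro Min_in) auto
    then obtain s1 where s1: "s1 \<in> L" "t1 = \<tau> s1" by blast
    have "a s + t0 * b s < a s' + t0 * b s'" if "s' \<in> L" for s'
    proof (rule ccontr)
      assume "\<not> ?thesis"
      then have "s' \<in> m S t0" using less.prems(1) that by (force simp: m_def L_def)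
      then show False using less.prems(2) that by (force simp: L_def)
    qed
    then have t01: "t0 < t1" using s1 tau_less by simp
    have s_min: "s \<in> m S t" if "t0 < t" "t \<le> t1" for t
    proof -
      have "a s + t * b s \<le> a s' + t * b s'" if s': "s' \<in> S" for s'
      proof (cases "s' \<in> L")
        case True
        have "t \<le> \<tau> s'" using t1_le[OF True] \<open>t \<le> t1\<close> by simp
        then show ?thesis using tau_le[OF True] by blast
      next
        case False
        then have "b s \<le> b s'" using s' by (auto simp: L_def)
        then have "(t - t0) * b s \<le> (t - t0) * b s'" using \<open>t0 < t\<close> by (simp add: mult_left_mono)
        moreover have "a s + t0 * b s \<le> a s' + t0 * b s'" using less.prems(1) s' by (simp add: m_def)
        ultimately show ?thesis by (simp add: algebra_simps)
      qed
      then show ?thesis using sS by (simp add: m_def)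
    qed
    have const: "b s' = b s" if "t0 < t" "t < t1" "s' \<in> m S t" for t s'
    proof (rule ccontr)
      assume "b s' \<noteq> b s"
      then have "b s' < b s" using mono[OF that(1,3)] by simp
      then have "s' \<in> L" using that(3) by (simp add: L_def m_def)
      then have "a s + t * b s < a s' + t * b s'" using t1_le[of s'] that(2) tau_less[of s' t] by simp
      then show False using that(3) sS by (auto simp: m_def)
    qed
    have s1_min: "s1 \<in> m S t1"
    proof -
      have "a s1 + t1 * b s1 = a s + t1 * b s"
        using tau_le[OF s1(1), of t1] tau_less[OF s1(1), of t1] s1(2) by auto
      then show ?thesis using s_min[of t1] t01 s1(1) by (simp add: m_def L_def)
    qed
    have "b s1 < b s" using s1 by (simp add: L_def)
    have t1D: "t1 \<in> D"
      using less.prems(5)[OF t01 s_min[OF t01] s1_min] \<open>b s1 < b s\<close> by auto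
    have "Min (b ` m S t1) \<in> b ` m S t1" using m_ne fin_m by (intro Min_in) auto
    \<comment> \<open>The line of least slope at \<open>t1\<close> is the minimal one just after
      \<open>t1\<close>; the induction continues from there.\<close>
    then obtain s2 where s2: "s2 \<in> m S t1" "b s2 = Min (b ` m S t1)" by auto
    have s2_le: "b s2 \<le> b s'" if "s' \<in> m S t1" for s' using that fin_m s2(2) by simp
    have "b s2 < b s" using s2_le[OF s1_min] \<open>b s1 < b s\<close> by simp
  moreover have "s2 \<in> S" using s2(1) by (simp add: m_def)
  then have "Min (b ` S) \<le> b s2" using fS by simp
    ultimately have dec: "nat (b s2 - Min (b ` S)) < nat (b s - Min (b ` S))" by simp
    have IH: "(\<Sum>t\<in>D \<inter> {t1<..}. Max (b ` m S t) - Min (b ` m S t)) = b s2 - Min (b ` S)"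
    proof (rule less.hyps[OF dec s2(1) s2_le])
      show "finite (D \<inter> {t1<..})" using less.prems(3) by simp
      show "t \<in> D \<inter> {t1<..}" if "t > t1" "x \<in> m S t" "y \<in> m S t" "b x \<noteq> b y" for t x y
        using less.prems(5)[of t x y] that t01 by auto
    qed auto
    have "Max (b ` m S t1) = b s"
      using s_min[of t1] t01 mono fin_m by (intro Max_eqI) auto
    then have at1: "Max (b ` m S t1) - Min (b ` m S t1) = b s - b s2" using s2 by simp
    have before: "(\<Sum>t\<in>D \<inter> {..<t1}. Max (b ` m S t) - Min (b ` m S t)) = 0"
    proof (rule sum.neutral, rule ballI)
      fix t assume "t \<in> D \<inter> {..<t1}"
      then show "Max (b ` m S t) - Min (b ` m S t) = 0"
        using less.prems(4) const by (intro jump0[OF m_ne, of _ "b s"]) auto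
    qed
    have D: "D = D \<inter> {..<t1} \<union> insert t1 (D \<inter> {t1<..})" using t1D by auto
    have "(\<Sum>t\<in>D. Max (b ` m S t) - Min (b ` m S t)) =
        (\<Sum>t\<in>D \<inter> {..<t1}. Max (b ` m S t) - Min (b ` m S t)) +
        (\<Sum>t\<in>insert t1 (D \<inter> {t1<..}). Max (b ` m S t) - Min (b ` m S t))"
      using less.prems(3) by (subst D, intro sum.union_disjoint) auto
    also have "\<dots> = b s - Min (b ` S)"
      using less.prems(3) by (simp add: before IH at1)
    finally show ?thesis .
  qed
qed

subsection \<open>Edges and local intersection numbers\<close>

lemma mem_minimizers:
  assumes "is_trop_poly f"
  shows "s \<in> minimizers f p \<longleftrightarrow>
    s \<in> supp f \<and> (\<forall>s'\<in>supp f. trop_term f s p \<le> trop_term f s' p)"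
proof -
  have fin: "finite ((\<lambda>s. trop_term f s p) ` supp f)" and ne: "(\<lambda>s. trop_term f s p) ` supp f \<noteq> {}"
    using assms by (auto simp: is_trop_poly_def)
  show ?thesis
    using Min_le[OF fin] Min_in[OF fin ne] unfolding minimizers_def trop_eval_def
    by (auto intro: antisym)
qed

lemma minimizers_subset: "minimizers f p \<subseteq> supp f"
  by (auto simp: minimizers_def)

lemma minimizers_nonempty:
  assumes "is_trop_poly f"
  shows "minimizers f p \<noteq> {}"
proof -
  have "trop_eval f p \<in> (\<lambda>s. trop_term f s p) ` supp f"
    unfolding trop_eval_def using assms by (intro Min_in) (auto simp: is_trop_poly_def)
  then obtain s where "s \<in> supp f" "trop_term f s p = trop_eval f p" by auto
  then have "s \<in> minimizers f p" by (simp add: minimizers_def)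
  then show ?thesis by blast
qed

lemma finite_minimizers: "is_trop_poly f \<Longrightarrow> finite (minimizers f p)"
  by (metis finite_subset minimizers_subset is_trop_poly_def)

lemma card_minimizers_eq_1:
  assumes "is_trop_poly f" "p \<notin> trop_curve f"
  obtains s where "minimizers f p = {s}"
proof -
  have "card (minimizers f p) \<noteq> 0"
    using finite_minimizers minimizers_nonempty assms(1) by simp
  then have "card (minimizers f p) = 1" using assms(2) by (simp add: trop_curve_def)
  then show thesis using that card_1_singletonE by metis
qed

text \<open>The affine hull of the cell containing \<open>p\<close> in its relative interior.\<close>

definition cell_plane :: "trop_poly \<Rightarrow> real \<times> real \<Rightarrow> (real \<times> real) set" where
  "cell_plane f p = {q. \<forall>s\<in>minimizers f p. \<forall>s'\<in>minimizers f p. trop_term f s q = trop_term f s' q}"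

lemma cell_planeD:
  "q \<in> cell_plane f p \<Longrightarrow> s \<in> minimizers f p \<Longrightarrow> s' \<in> minimizers f p \<Longrightarrow>
    trop_term f s q = trop_term f s' q"
  unfolding cell_plane_def by blast

lemma affine_cell_plane: "affine (cell_plane f p)"
proof -
  have eq: "cell_plane f p = (\<Inter>s\<in>minimizers f p. \<Inter>s'\<in>minimizers f p.
      {q. (ivec s - ivec s') \<bullet> q = coef f s' - coef f s})"
    by (auto simp: cell_plane_def trop_term_def inner_diff_left algebra_simps)
  show ?thesis unfolding eq by (intro affine_Inter) (auto intro!: affine_Inter affine_hyperplane)
qed

text \<open>Having the same minimizers as \<open>p\<close> means keeping the ties among them and
  finitely many strict inequalities against the other terms. So these points form a nonempty
  relatively open subset of \<open>cell_plane f p\<close>, which determines the affine hull.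
  Conversely, from a point of the relative interior one can move a little further away from
  \<open>p\<close> inside the cell, which rules out additional minimizers.\<close>

lemma dual_cell_eq:
  assumes "is_trop_poly f"
  shows "affine hull (dual_cell f p) = cell_plane f p"
    and "rel_interior (dual_cell f p) = {q. minimizers f q = minimizers f p}"
proof -
  note mem = mem_minimizers[OF assms]
  define T where "T = {q. \<forall>s\<in>minimizers f p. \<forall>s'\<in>supp f - minimizers f p. trop_term f s q < trop_term f s' q}"
  have T_eq: "T = (\<Inter>s\<in>minimizers f p. \<Inter>s'\<in>supp f - minimizers f p.
      {q. (ivec s - ivec s') \<bullet> q < coef f s' - coef f s})"
    by (auto simp: T_def trop_term_def inner_diff_left algebra_simps)
  have "finite (supp f)" using assms by (simp add: is_trop_poly_def)
  then have openT: "open T"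
    unfolding T_eq using finite_minimizers[OF assms]
    by (intro open_INT ballI open_halfspace_lt) auto
  obtain s0 where s0: "s0 \<in> minimizers f p" using minimizers_nonempty[OF assms] by blast
  have strict: "{q. minimizers f q = minimizers f p} = cell_plane f p \<inter> T"
  proof (intro set_eqI iffI)
    fix q assume "q \<in> {q. minimizers f q = minimizers f p}"
    then have q: "minimizers f q = minimizers f p" by simp
    have "trop_term f s q = trop_eval f q" if "s \<in> minimizers f p" for s
      using that unfolding q[symmetric] by (simp add: minimizers_def)
    then have "q \<in> cell_plane f p" unfolding cell_plane_def by simp
    moreover have "q \<in> T"
      unfolding T_def
    proof (clarify, rule ccontr)
      fix s a b assume s: "s \<in> minimizers f p" and ab: "(a, b) \<in> supp f" "(a, b) \<notin> minimizers f p"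
        and "\<not> trop_term f s q < trop_term f (a, b) q"
      then have "(a, b) \<in> minimizers f q" using s unfolding q[symmetric] mem by force
      then show False using ab q by simp
    qed
    ultimately show "q \<in> cell_plane f p \<inter> T" by blast
  next
    fix q assume q: "q \<in> cell_plane f p \<inter> T"
    have "s \<in> minimizers f q" if s: "s \<in> minimizers f p" for s
      unfolding mem
    proof (intro conjI ballI)
      show "s \<in> supp f" using s by (simp add: mem)
      fix s' assume "s' \<in> supp f"
      then show "trop_term f s q \<le> trop_term f s' q"
        using q s cell_planeD[of q f p s s']
        by (cases "s' \<in> minimizers f p") (auto simp: T_def intro: less_imp_le)
    qed
    moreover have "s \<in> minimizers f p" if s: "s \<in> minimizers f q" for s
    proof (rule ccontr)
      assume "s \<notin> minimizers f p"
      then have "trop_term f s0 q < trop_term f s q" using q s0 s by (auto simp: T_def mem)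
      then show False using s s0 by (auto simp: mem)
    qed
    ultimately show "q \<in> {q. minimizers f q = minimizers f p}" by blast
  qed
  have sub1: "cell_plane f p \<inter> T \<subseteq> dual_cell f p"
    unfolding strict[symmetric] by (auto simp: dual_cell_def)
  have sub2: "dual_cell f p \<subseteq> cell_plane f p"
  proof
    fix q assume q: "q \<in> dual_cell f p"
    have "trop_term f s q = trop_eval f q" if "s \<in> minimizers f p" for s
      using q that by (auto simp: dual_cell_def minimizers_def)
    then show "q \<in> cell_plane f p" unfolding cell_plane_def by simp
  qed
  have "p \<in> cell_plane f p \<inter> T" unfolding strict[symmetric] by simp
  then have "cell_plane f p \<inter> T \<noteq> {}" by blast
  then have "affine hull (cell_plane f p \<inter> T) = affine hull (cell_plane f p)"
    by (rule affine_hull_affine_Int_open[OF affine_cell_plane openT])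
  also have "\<dots> = cell_plane f p"
    unfolding affine_hull_eq by (rule affine_cell_plane)
  finally have "affine hull (cell_plane f p \<inter> T) = cell_plane f p" .
  then show aff: "affine hull (dual_cell f p) = cell_plane f p"
    using hull_mono[OF sub1, of affine] hull_minimal[where S = affine, OF sub2 affine_cell_plane] by simp
  show "rel_interior (dual_cell f p) = {q. minimizers f q = minimizers f p}"
  proof
    show "{q. minimizers f q = minimizers f p} \<subseteq> rel_interior (dual_cell f p)"
      unfolding strict
    proof
      fix q assume q: "q \<in> cell_plane f p \<inter> T"
      then show "q \<in> rel_interior (dual_cell f p)"
        unfolding mem_rel_interior aff using openT sub1 by (intro exI[of _ T]) blast
    qed
    show "rel_interior (dual_cell f p) \<subseteq> {q. minimizers f q = minimizers f p}"
    proof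
      fix q assume q: "q \<in> rel_interior (dual_cell f p)"
      have pd: "p \<in> dual_cell f p" by (simp add: dual_cell_def)
      have qd: "q \<in> dual_cell f p" using q rel_interior_subset by blast
      obtain e where e: "e > 0" "ball q e \<inter> cell_plane f p \<subseteq> dual_cell f p"
        using q unfolding mem_rel_interior_ball aff by blast
      define r where "r = norm (q - p)"
      have "r \<ge> 0" by (simp add: r_def)
      \<comment> \<open>This makes the step from \<open>q\<close> to \<open>x\<close> shorter than
        \<open>e\<close>; the summand 1 covers the case \<open>q = p\<close>.\<close>
      define d where "d = e / (2 * (r + 1))"
      have d: "d > 0" using e(1) \<open>r \<ge> 0\<close> by (simp add: d_def)
      define x where "x = q + d *\<^sub>R (q - p)"
      have "2 * (r + 1) * d = e" using \<open>r \<ge> 0\<close> by (simp add: d_def)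
      moreover have "r * d \<ge> 0" using \<open>r \<ge> 0\<close> d by simp
      ultimately have "d * norm (q - p) < e"
        using d by (simp add: algebra_simps flip: r_def)
      then have "x \<in> ball q e" using d by (simp add: x_def dist_norm)
      moreover have "x \<in> cell_plane f p"
      proof -
        have "x = (- d) *\<^sub>R p + (1 + d) *\<^sub>R q" by (simp add: x_def algebra_simps)
        then show ?thesis using pd qd sub2 by (auto simp only: intro!: mem_affine[OF affine_cell_plane])
      qed
      ultimately have xd: "x \<in> dual_cell f p" using e(2) by blast
      \<comment> \<open>A term that is larger than the minimum at \<open>p\<close> but not at
        \<open>q\<close> would, being affine, be below the minimum at \<open>x\<close>, beyond
        \<open>q\<close>.\<close>
      have "q \<in> T" unfolding T_def
      proof (intro CollectI ballI, rule ccontr)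
        fix s s' assume s: "s \<in> minimizers f p" and s': "s' \<in> supp f - minimizers f p"
          and "\<not> trop_term f s q < trop_term f s' q"
        then have le: "trop_term f s' q \<le> trop_term f s q" by simp
        have sq: "s \<in> minimizers f q" "s \<in> minimizers f x" using qd xd s by (auto simp: dual_cell_def)
        have "trop_term f s p < trop_term f s' p"
        proof (rule ccontr)
          assume "\<not> ?thesis"
          then have "s' \<in> minimizers f p" using s s' unfolding mem by force
          then show False using s' by simp
        qed
        moreover have "trop_term f s x \<le> trop_term f s' x"
          using sq(2) s' by (simp add: mem)
        moreover have "trop_term f r x = (1 + d) * trop_term f r q - d * trop_term f r p" for r
          by (simp add: trop_term_def x_def inner_add_right inner_diff_right algebra_simps)
        ultimately have "d * (trop_term f s' p - trop_term f s p) \<le> (1 + d) * (trop_term f s' q - trop_term f s q)"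
          "trop_term f s' p - trop_term f s p > 0"
          by (simp_all add: algebra_simps)
        moreover have "(1 + d) * (trop_term f s' q - trop_term f s q) \<le> 0"
          using le d by (simp add: mult_le_0_iff)
        ultimately show False using d mult_pos_pos by (smt (verit))
      qed
      then show "q \<in> {q. minimizers f q = minimizers f p}" using qd sub2 strict by blast
    qed
  qed
qed

section \<open>Edges, their directions and local intersection numbers\<close>

lemma orthogonal_complement_primitive:
  assumes "primitive u" "z \<noteq> 0" "idot z u = 0" "ivec z \<bullet> x = 0"
  shows "x \<in> span {ivec u}"
proof -
  obtain k where k: "z = (- k * snd u, k * fst u)" using orthogonal_primitive assms(1,3) by blast
  then have "k \<noteq> 0" using assms(2) by (auto simp: zero_prod_def)
  have "of_int k * (fst u * snd x - snd u * fst x) = (0 :: real)"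
    using assms(4) by (simp add: k ivec_def inner_prod_def algebra_simps)
  then have det: "real_of_int (fst u) * snd x = real_of_int (snd u) * fst x"
    using \<open>k \<noteq> 0\<close> by simp
  show ?thesis
  proof (cases "fst u = 0")
    case True
    then have su: "snd u \<noteq> 0" using assms(1) by (auto simp: primitive_def)
    then have "x = (snd x / snd u) *\<^sub>R ivec u" using det True by (simp add: ivec_def prod_eq_iff)
    then show ?thesis by (metis span_base span_scale singletonI)
  next
    case False
    then have "x = (fst x / fst u) *\<^sub>R ivec u" using det by (simp add: ivec_def prod_eq_iff field_simps)
    then show ?thesis by (metis span_base span_scale singletonI)
  qed
qed

text \<open>A tie between two distinct minimizers confines \<open>q - p\<close> to the line spanned
  by \<open>u\<close>; moving along \<open>u\<close> changes all minimizing terms by the same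
  amount.\<close>

lemma cell_plane_line:
  assumes "is_trop_poly f" "p \<in> trop_curve f" "orth (minimizers f p) u"
  shows "cell_plane f p = (+) p ` span {ivec u}"
proof -
  have pu: "primitive u" using assms(3) by (simp add: orth_def)
  obtain s s' where s: "s \<in> minimizers f p" "s' \<in> minimizers f p" "s \<noteq> s'"
    using assms(2) obtain_two unfolding trop_curve_def by blast
  have eqp: "trop_term f r p = trop_term f r' p"
    if "r \<in> minimizers f p" "r' \<in> minimizers f p" for r r' using that by (simp add: minimizers_def)
  show ?thesis
  proof (intro set_eqI iffI)
    fix q assume "q \<in> cell_plane f p"
    then have "trop_term f s q = trop_term f s' q" using s(1,2) by (rule cell_planeD)
    then have "ivec (s - s') \<bullet> (q - p) = 0"
      using eqp[OF s(1,2)] by (simp add: trop_term_def ivec_diff inner_diff_left inner_diff_right algebra_simps)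
    moreover have "idot (s - s') u = 0" using orthD[OF assms(3) s(1,2)] by (simp add: idot_diff_left)
    ultimately have "q - p \<in> span {ivec u}"
      using orthogonal_complement_primitive[OF pu, of "s - s'"] s(3) by simp
    then show "q \<in> (+) p ` span {ivec u}" by (metis add.commute diff_add_cancel image_eqI)
  next
    fix q assume "q \<in> (+) p ` span {ivec u}"
    then obtain k where q: "q = p + k *\<^sub>R ivec u" unfolding span_singleton by blast
    have at_q: "trop_term f r q = trop_term f r p + k * idot r u" for r
      by (simp add: q trop_term_def inner_add_right ivec_inner_ivec)
    then show "q \<in> cell_plane f p"
      unfolding cell_plane_def
    proof (intro CollectI ballI)
      fix r r' assume "r \<in> minimizers f p" "r' \<in> minimizers f p"
      then show "trop_term f r q = trop_term f r' q"
        using eqp[of r r'] orthD[OF assms(3), of r r'] at_q by simp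
    qed
  qed
qed

text \<open>The minimizers are constant on the relative interior of a cell and determine the cell.
  Hence the edge described in \<open>edge_through\<close> is unique.\<close>

lemma edge_eq_dual_cell:
  assumes "is_trop_poly f" "e \<in> trop_edges f" "p \<in> rel_interior e"
  shows "e = dual_cell f p"
proof -
  obtain q where "e = dual_cell f q" using assms(2) by (auto simp: trop_edges_def trop_cells_def)
  moreover then have "minimizers f p = minimizers f q"
    using assms(1,3) dual_cell_eq(2) by blast
  ultimately show ?thesis by (simp add: dual_cell_def)
qed

lemma aff_dim_line: "u \<noteq> 0 \<Longrightarrow> aff_dim ((+) (p :: real \<times> real) ` span {u}) = 1"
  by (simp add: aff_dim_translation_eq aff_dim_subspace dim_span)

text \<open>The cell around \<open>p\<close> spans the plane where the minimizers tie, and this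
  plane is a line exactly if the minimizers are collinear. Transversality thereby becomes a
  condition on sets of minimizers.\<close>

lemma edge_iff_orth:
  assumes "is_trop_poly f" "p \<in> trop_curve f"
  shows "(\<exists>e\<in>trop_edges f. p \<in> rel_interior e) \<longleftrightarrow> (\<exists>u. orth (minimizers f p) u)"
proof
  assume "\<exists>e\<in>trop_edges f. p \<in> rel_interior e"
  then have "dual_cell f p \<in> trop_edges f" using edge_eq_dual_cell[OF assms(1)] by metis
  then have "aff_dim (dual_cell f p) = 1" by (simp add: trop_edges_def)
  then have dim: "aff_dim (cell_plane f p) = 1"
    using dual_cell_eq(1)[OF assms(1)] aff_dim_affine_hull by metis
  obtain s s' where s: "s \<in> minimizers f p" "s' \<in> minimizers f p" "s \<noteq> s'"
    using assms(2) obtain_two unfolding trop_curve_def by blast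
  obtain u where u: "primitive u" "idot (s - s') u = 0" using obtain_primitive[of "s - s'"] s(3) by auto
  have "p \<in> cell_plane f p" by (simp add: cell_plane_def minimizers_def)
  \<comment> \<open>Dimension one provides a second point of the plane, whose direction from
    \<open>p\<close> is orthogonal to all differences of minimizers at once.\<close>
  obtain q where q: "q \<in> cell_plane f p" "q \<noteq> p"
  proof (rule ccontr)
    assume "\<not> thesis"
    then have "cell_plane f p \<subseteq> {p}" using that by blast
    then show False using dim aff_dim_subset[of "cell_plane f p" "{p}"] by simp
  qed
  have orth_q: "ivec (r - r') \<bullet> (q - p) = 0" if "r \<in> minimizers f p" "r' \<in> minimizers f p" for r r'
    using that cell_planeD[OF q(1) that]
    by (simp add: minimizers_def trop_term_def ivec_diff inner_diff_left inner_diff_right)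
  then have "q - p \<in> span {ivec u}"
    using orthogonal_complement_primitive[OF u(1) _ u(2)] s by simp
  then obtain k where k: "q - p = k *\<^sub>R ivec u" by (auto simp: span_singleton)
  then have "k \<noteq> 0" using q(2) by auto
  have "idot r u = idot r' u" if "r \<in> minimizers f p" "r' \<in> minimizers f p" for r r'
    using orth_q[OF that] \<open>k \<noteq> 0\<close> by (simp add: k ivec_inner_ivec idot_diff_left)
  then show "\<exists>u. orth (minimizers f p) u" using u(1) unfolding orth_def by blast
next
  assume "\<exists>u. orth (minimizers f p) u"
  then obtain u where u: "orth (minimizers f p) u" ..
  then have "ivec u \<noteq> 0" using primitive_nonzero by (auto simp: orth_def)
  then have "aff_dim (cell_plane f p) = 1"
    using cell_plane_line[OF assms u] aff_dim_line by simp
  then have "aff_dim (dual_cell f p) = 1"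
    using dual_cell_eq(1)[OF assms(1)] aff_dim_affine_hull by metis
  then have "dual_cell f p \<in> trop_edges f" using assms(2) by (simp add: trop_edges_def trop_cells_def)
  moreover have "p \<in> rel_interior (dual_cell f p)" by (simp add: dual_cell_eq[OF assms(1)])
  ultimately show "\<exists>e\<in>trop_edges f. p \<in> rel_interior e" by blast
qed

text \<open>This evaluates the choice operators in the definition of local intersection numbers: the
  edge is the cell of \<open>p\<close>, and a primitive direction is determined up to sign by the
  line that the cell spans.\<close>

lemma edge_data:
  assumes "is_trop_poly f" "p \<in> trop_curve f" "orth (minimizers f p) u"
  shows "edge_weight f (edge_through f p) = wt (minimizers f p)"
    and "primitive_direction (edge_through f p) = u \<or> primitive_direction (edge_through f p) = - u"
proof -
  obtain e where e: "e \<in> trop_edges f" "p \<in> rel_interior e"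
    using edge_iff_orth[OF assms(1,2)] assms(3) by blast
  have through: "edge_through f p = dual_cell f p"
    unfolding edge_through_def using e edge_eq_dual_cell[OF assms(1)] by (metis (mono_tags, lifting) the_equality)
  have "{s \<in> supp f. \<forall>q\<in>rel_interior (dual_cell f p). s \<in> minimizers f q} = minimizers f p"
    unfolding dual_cell_eq(2)[OF assms(1)] using minimizers_subset[of f p] by blast
  then show "edge_weight f (edge_through f p) = wt (minimizers f p)"
    by (simp add: edge_weight_def dual_edge_def wt_def through)
  have pu: "primitive u" using assms(3) by (simp add: orth_def)
  have hull: "affine hull (dual_cell f p) = (+) p ` span {ivec u}"
    using dual_cell_eq(1)[OF assms(1)] cell_plane_line[OF assms] by simp
  define v where "v = primitive_direction (edge_through f p)"
  \<comment> \<open>The witness \<open>u\<close> shows that the choice in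
    \<open>primitive_direction\<close> is not void.\<close>
  have "\<exists>v. primitive v \<and> affine_parallel (span {ivec v}) (affine hull (dual_cell f p))"
    using pu unfolding hull affine_parallel_def by blast
  then have "primitive v \<and> affine_parallel (span {ivec v}) (affine hull (dual_cell f p))"
    unfolding v_def primitive_direction_def through by (rule someI_ex)
  then have pv: "primitive v" and par: "affine_parallel (span {ivec v}) ((+) p ` span {ivec u})"
    by (simp_all add: hull)
  have "affine_parallel (span {ivec v}) (span {ivec u})"
    using par affine_parallel_assoc affine_parallel_commute
    by (metis affine_parallel_def)
  then have "span {ivec v} = span {ivec u}" using parallel_subspace subspace_span by blast
  then have "ivec v \<in> span {ivec u}" by (metis span_base singletonI)
  then obtain k where k: "ivec v = k *\<^sub>R ivec u" by (auto simp: span_singleton)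
  then have "real_of_int (fst v) = k * fst u" "real_of_int (snd v) = k * snd u"
    by (simp_all add: ivec_def)
  then have "real_of_int (det2 u v) = 0" by (simp add: det2_def)
  then have "det2 u v = 0" by linarith
  then show "primitive_direction (edge_through f p) = u \<or> primitive_direction (edge_through f p) = - u"
    using primitive_parallel[OF pu pv] by (simp add: v_def)
qed

text \<open>The weight of the edge of \<open>f\<close> and the determinant merge into a drop in
  slope of \<open>f\<close> along the edge of \<open>g\<close>, by \<open>wt_mult_det2\<close>; the
  weight of the edge of \<open>g\<close> stays as a factor.\<close>

lemma local_intersection_eq:
  assumes "is_trop_poly f" "p \<in> trop_curve f" "orth (minimizers f p) u"
    and "is_trop_poly g" "p \<in> trop_curve g" "orth (minimizers g p) v"
  shows "int (local_intersection f g p) = int (wt (minimizers g p)) * width (minimizers f p) v"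
proof -
  have "\<bar>det2 (primitive_direction (edge_through f p)) (primitive_direction (edge_through g p))\<bar> = \<bar>det2 u v\<bar>"
    using edge_data(2)[OF assms(1-3)] edge_data(2)[OF assms(4-6)]
    by (auto simp: det2_def)
  moreover have "int (wt (minimizers f p)) * \<bar>det2 u v\<bar> = width (minimizers f p) v"
    using wt_mult_det2[OF finite_minimizers minimizers_nonempty assms(3)] assms(1) by blast
  ultimately show ?thesis
    by (simp add: local_intersection_def Let_def edge_data(1)[OF assms(1-3)] edge_data(1)[OF assms(4-6)])
qed

lemma local_intersection_commute: "local_intersection f g p = local_intersection g f p"
  by (simp add: local_intersection_def Let_def det2_commute mult.commute)

lemma intersection_number_commute: "intersection_number f g = intersection_number g f"
  by (simp add: intersection_number_def local_intersection_commute Int_commute)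

lemma transversal_commute: "transversal f g \<longleftrightarrow> transversal g f"
  unfolding transversal_def by (auto simp: Int_commute)

lemma transversal_iff:
  assumes "is_trop_poly f" "is_trop_poly g"
  shows "transversal f g \<longleftrightarrow> finite (trop_curve f \<inter> trop_curve g) \<and>
    (\<forall>p\<in>trop_curve f \<inter> trop_curve g. (\<exists>u. orth (minimizers f p) u) \<and> (\<exists>v. orth (minimizers g p) v))"
  unfolding transversal_def using edge_iff_orth[OF assms(1)] edge_iff_orth[OF assms(2)] by auto

subsection \<open>Fans\<close>

text \<open>Up to signs the support function of the convex hull of \<open>S\<close>: the slope of a
  tropical polynomial with support \<open>S\<close> far out in direction \<open>u\<close>.\<close>

definition hmin :: "(int \<times> int) set \<Rightarrow> int \<times> int \<Rightarrow> int" where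
  "hmin S u = Min ((\<lambda>s. idot s u) ` S)"

text \<open>The primitive inner normals of the edges of the convex hull; a segment has two, opposite
  to each other.\<close>

definition normals :: "(int \<times> int) set \<Rightarrow> (int \<times> int) set" where
  "normals S = {u. primitive u \<and> card (face S (ivec u)) \<ge> 2}"

text \<open>The term of \<open>s\<close> at \<open>p\<close> is
  \<open>ivec s \<bullet> (p - c)\<close>, so the curve is an inner normal fan with apex
  \<open>c\<close>.\<close>

definition fan :: "(int \<times> int) set \<Rightarrow> real \<times> real \<Rightarrow> trop_poly" where
  "fan S c = \<lparr>supp = S, coef = (\<lambda>s. - (ivec s \<bullet> c))\<rparr>"

text \<open>A relation between \<open>g\<close> and \<open>c\<close>, since the apex is not unique:
  if the support is collinear, it can slide along the curve.\<close>

definition is_fan :: "trop_poly \<Rightarrow> real \<times> real \<Rightarrow> bool" where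
  "is_fan g c \<longleftrightarrow> (\<forall>p. minimizers g p = face (supp g) (p - c))"

lemma is_fanD: "is_fan g c \<Longrightarrow> minimizers g p = face (supp g) (p - c)"
  unfolding is_fan_def by blast

lemma supp_fan [simp]: "supp (fan S c) = S"
  by (simp add: fan_def)

lemma is_trop_poly_fan [simp]: "is_trop_poly (fan S c) \<longleftrightarrow> finite S \<and> S \<noteq> {}"
  by (simp add: is_trop_poly_def)

lemma is_fan_fan: "finite S \<Longrightarrow> S \<noteq> {} \<Longrightarrow> is_fan (fan S c) c"
  unfolding is_fan_def set_eq_iff
  by (simp add: mem_minimizers face_def trop_term_def inner_diff_right) (simp add: fan_def)

lemma translate_fan: "translate v (fan S c) = fan S (c - v)"
  by (simp add: translate_def fan_def inner_diff_right)

lemma face_scale: "t > 0 \<Longrightarrow> face S (t *\<^sub>R d) = face S d"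
  by (auto simp: face_def)

lemma orth_face: "primitive u \<Longrightarrow> orth (face S (ivec u)) u"
  unfolding orth_def face_def by (auto simp: ivec_inner_ivec intro: antisym)

text \<open>Every normal is orthogonal to the difference of two distinct points of \<open>S\<close>,
  and by \<open>orth_unique\<close> each pair admits at most two primitive vectors.\<close>

lemma finite_normals:
  assumes "finite S"
  shows "finite (normals S)"
proof -
  have fin: "finite {u. orth {s, s'} u}" if "s \<noteq> s'" for s s'
  proof (cases "{u. orth {s, s'} u} = {}")
    case False
    then obtain u where "orth {s, s'} u" by blast
    then have "{u. orth {s, s'} u} \<subseteq> {u, - u}"
      using orth_unique[of "{s, s'}" u] that by auto
    then show ?thesis using finite_subset by blast
  next
    case True
    then show ?thesis by (simp only: finite.emptyI)
  qed
  have "normals S \<subseteq> (\<Union>(s, s') \<in> {(s, s') \<in> S \<times> S. s \<noteq> s'}. {u. orth {s, s'} u})"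
  proof
    fix u assume u: "u \<in> normals S"
    then obtain s s' where s: "s \<in> face S (ivec u)" "s' \<in> face S (ivec u)" "s \<noteq> s'"
      unfolding normals_def using obtain_two by blast
    have "orth (face S (ivec u)) u" using u orth_face by (simp add: normals_def)
    then have "orth {s, s'} u" using s unfolding orth_def by blast
    moreover have "s \<in> S" "s' \<in> S" using s by (auto simp: face_def)
    ultimately show "u \<in> (\<Union>(s, s') \<in> {(s, s') \<in> S \<times> S. s \<noteq> s'}. {u. orth {s, s'} u})"
      using s(3) by blast
  qed
  moreover have "finite {(s, s') \<in> S \<times> S. s \<noteq> s'}"
    using assms by (auto intro: finite_subset[of _ "S \<times> S"])
  then have "finite (\<Union>(s, s') \<in> {(s, s') \<in> S \<times> S. s \<noteq> s'}. {u. orth {s, s'} u})"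
  proof (rule finite_UN_I)
    fix x assume "x \<in> {(s, s') \<in> S \<times> S. s \<noteq> s'}"
    then show "finite (case x of (s, s') \<Rightarrow> {u. orth {s, s'} u})"
      using fin by (cases x) simp
  qed
  ultimately show ?thesis by (rule finite_subset)
qed

text \<open>A tie in direction \<open>d\<close> makes \<open>d\<close> orthogonal to a nonzero
  integer vector, so \<open>d\<close> has rational slope and lies on the ray of a primitive
  vector.\<close>

lemma ray_of_face:
  assumes "card (face T d) \<ge> 2" "d \<noteq> 0"
  obtains u t where "u \<in> normals T" "t > 0" "d = t *\<^sub>R ivec u" "face T d = face T (ivec u)"
proof -
  obtain s s' where s: "s \<in> face T d" "s' \<in> face T d" "s \<noteq> s'"
    using obtain_two[OF assms(1)] by blast
  obtain u where u: "primitive u" "idot (s - s') u = 0" using obtain_primitive[of "s - s'"] s(3) by auto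
  have "ivec (s - s') \<bullet> d = 0"
    using s(1,2) by (auto simp: face_def ivec_diff inner_diff_left intro: antisym)
  then have "d \<in> span {ivec u}"
    using orthogonal_complement_primitive[OF u(1) _ u(2)] s(3) by simp
  then obtain k where k: "d = k *\<^sub>R ivec u" unfolding span_singleton by blast
  define w where "w = (if k > 0 then u else - u)"
  have "ivec (- u) = - ivec u" by (simp add: ivec_def)
  then have d: "d = \<bar>k\<bar> *\<^sub>R ivec w" using k by (simp add: w_def)
  have "\<bar>k\<bar> > 0" using assms(2) k by auto
  moreover have "primitive w" using u(1) by (simp add: w_def primitive_def)
  moreover have "face T d = face T (ivec w)" using d \<open>\<bar>k\<bar> > 0\<close> face_scale by metis
  ultimately show thesis using that[of w "\<bar>k\<bar>"] d assms(1) by (simp add: normals_def)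
qed

lemma ray_unique:
  assumes "primitive u" "primitive v" "s > 0" "t > 0" "s *\<^sub>R ivec u = t *\<^sub>R ivec v"
  shows "u = v \<and> s = t"
proof -
  have eq: "s * fst u = t * fst v" "s * snd u = t * snd v" using assms(5) by (auto simp: ivec_def)
  have "s * t * real_of_int (det2 u v) = (s * fst u) * (t * snd v) - (s * snd u) * (t * fst v)"
    by (simp add: det2_def algebra_simps)
  also have "\<dots> = 0" unfolding eq by simp
  finally have "det2 u v = 0" using assms(3,4) by simp
  then consider "v = u" | "v = - u" using primitive_parallel[OF assms(1,2)] by blast
  then show ?thesis
  proof cases
    case 1
    then show ?thesis using assms(5) primitive_nonzero[OF assms(1)] by simp
  next
    case 2
    then have "(s + t) * fst u = 0" "(s + t) * snd u = 0" using eq by (simp_all add: algebra_simps)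
    then have "fst u = 0" "snd u = 0" using assms(3,4) by auto
    then show ?thesis using assms(1) by (simp add: primitive_def)
  qed
qed

text \<open>On the ray, \<open>f\<close> is a lower envelope of lines with slopes
  \<open>idot s u\<close>. It starts with the slope of \<open>s0\<close>, the only minimizer at
  \<open>c\<close>, and all its breakpoints lie on the curve.\<close>

lemma jumps_along_ray:
  assumes "is_trop_poly f" "minimizers f c = {s0}"
    and "finite {t. t > 0 \<and> c + t *\<^sub>R ivec u \<in> trop_curve f}"
  shows "(\<Sum>t | t > 0 \<and> c + t *\<^sub>R ivec u \<in> trop_curve f. width (minimizers f (c + t *\<^sub>R ivec u)) u) =
    idot s0 u - hmin (supp f) u"
proof -
  define a where "a s = trop_term f s c" for s
  define m where "m t = {s \<in> supp f. \<forall>s'\<in>supp f. a s + t * idot s u \<le> a s' + t * idot s' u}" for t :: real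
  have m_eq: "m t = minimizers f (c + t *\<^sub>R ivec u)" for t
    unfolding m_def a_def set_eq_iff mem_minimizers[OF assms(1)]
    by (simp add: trop_term_def inner_add_right ivec_inner_ivec add.assoc)
  have "finite (supp f)" using assms(1) by (simp add: is_trop_poly_def)
  moreover have "m 0 = {s0}" using assms(2) by (simp add: m_eq)
  moreover have "t \<in> {t. t > 0 \<and> c + t *\<^sub>R ivec u \<in> trop_curve f}"
    if "t > 0" "s \<in> m t" "s' \<in> m t" "idot s u \<noteq> idot s' u" for t s s'
  proof -
    have "card {s, s'} \<le> card (m t)"
      using that finite_minimizers[OF assms(1)] by (intro card_mono) (auto simp: m_eq)
    then show ?thesis using that by (auto simp: trop_curve_def m_eq card_insert_if split: if_splits)
  qed
  ultimately show ?thesis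
    using envelope_jumps[where S = "supp f" and s = s0 and ?t0.0 = 0 and a = a and
        b = "\<lambda>s. idot s u" and D = "{t. t > 0 \<and> c + t *\<^sub>R ivec u \<in> trop_curve f}"] assms(3)
    unfolding m_def[symmetric] hmin_def width_def m_eq by auto
qed

text \<open>As the apex \<open>c\<close> is off the curve of \<open>f\<close>, every intersection
  point lies on exactly one open ray of the fan, and the drops in slope are added up ray by
  ray.\<close>

lemma intersection_number_fan_unbalanced:
  assumes "is_trop_poly f" "is_trop_poly g" "transversal f g"
    and "is_fan g c" "minimizers f c = {s0}"
  shows "int (intersection_number f g) =
    (\<Sum>u\<in>normals (supp g). int (wt (face (supp g) (ivec u))) * (idot s0 u - hmin (supp f) u))"
proof -
  define N where "N = normals (supp g)"
  define D where "D u = {t. t > 0 \<and> c + t *\<^sub>R ivec u \<in> trop_curve f}" for u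
  have tr: "finite (trop_curve f \<inter> trop_curve g)"
    "\<And>p. p \<in> trop_curve f \<Longrightarrow> p \<in> trop_curve g \<Longrightarrow> \<exists>u. orth (minimizers f p) u"
    using assms(1-3) transversal_iff by auto
  have fN: "finite N" using assms(2) finite_normals by (simp add: N_def is_trop_poly_def)
  have min_g: "minimizers g (c + t *\<^sub>R ivec u) = face (supp g) (ivec u)" if "t > 0" for t u
    using that by (simp add: is_fanD[OF assms(4)] face_scale)
  have in_g: "c + t *\<^sub>R ivec u \<in> trop_curve g" if "u \<in> N" "t > 0" for t u
    using that min_g by (simp add: N_def normals_def trop_curve_def)
  have c_notin: "c \<notin> trop_curve f" using assms(5) by (simp add: trop_curve_def)
  have bij: "bij_betw (\<lambda>(u, t). c + t *\<^sub>R ivec u) (SIGMA u:N. D u) (trop_curve f \<inter> trop_curve g)"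
    unfolding bij_betw_def
  proof
    show "inj_on (\<lambda>(u, t). c + t *\<^sub>R ivec u) (SIGMA u:N. D u)"
      using ray_unique by (auto simp: inj_on_def D_def N_def normals_def)
    show "(\<lambda>(u, t). c + t *\<^sub>R ivec u) ` (SIGMA u:N. D u) = trop_curve f \<inter> trop_curve g"
    proof
      show "(\<lambda>(u, t). c + t *\<^sub>R ivec u) ` (SIGMA u:N. D u) \<subseteq> trop_curve f \<inter> trop_curve g"
        using in_g by (auto simp: D_def)
      show "trop_curve f \<inter> trop_curve g \<subseteq> (\<lambda>(u, t). c + t *\<^sub>R ivec u) ` (SIGMA u:N. D u)"
      proof
        fix p assume p: "p \<in> trop_curve f \<inter> trop_curve g"
        then have "card (face (supp g) (p - c)) \<ge> 2" "p - c \<noteq> 0"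
          using is_fanD[OF assms(4), of p] c_notin by (auto simp: trop_curve_def)
        then obtain u t where u: "u \<in> N" "t > 0" "p - c = t *\<^sub>R ivec u"
          using ray_of_face unfolding N_def by metis
        then have "p = c + t *\<^sub>R ivec u" by (metis add.commute diff_add_cancel)
        then show "p \<in> (\<lambda>(u, t). c + t *\<^sub>R ivec u) ` (SIGMA u:N. D u)"
          using p u by (force simp: D_def)
      qed
    qed
  qed
  have fD: "finite (D u)" if "u \<in> N" for u
  proof -
    have "finite (SIGMA u:N. D u)" using bij tr(1) bij_betw_finite by blast
    then have "finite (snd ` ({u} \<times> D u))"
      using that by (intro finite_imageI finite_subset[of "{u} \<times> D u" "SIGMA u:N. D u"]) auto
    then show ?thesis by simp
  qed
  have loc: "int (local_intersection f g (c + t *\<^sub>R ivec u)) =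
      int (wt (face (supp g) (ivec u))) * width (minimizers f (c + t *\<^sub>R ivec u)) u"
    if uN: "u \<in> N" and tD: "t \<in> D u" for u t
  proof -
    have t: "t > 0" "c + t *\<^sub>R ivec u \<in> trop_curve f" using tD by (auto simp: D_def)
    obtain v where "orth (minimizers f (c + t *\<^sub>R ivec u)) v" using tr(2)[OF t(2) in_g[OF uN t(1)]] ..
    moreover have "orth (minimizers g (c + t *\<^sub>R ivec u)) u"
      using uN orth_face by (simp add: min_g t N_def normals_def)
    ultimately show ?thesis
      using local_intersection_eq[OF assms(1) t(2) _ assms(2) in_g[OF uN t(1)]]
      by (simp add: min_g t)
  qed
  have "int (intersection_number f g) = (\<Sum>p\<in>trop_curve f \<inter> trop_curve g. int (local_intersection f g p))"
    by (simp add: intersection_number_def)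
  also have "\<dots> = (\<Sum>(u, t)\<in>(SIGMA u:N. D u). int (local_intersection f g (c + t *\<^sub>R ivec u)))"
    using sum.reindex_bij_betw[OF bij, of "\<lambda>p. int (local_intersection f g p)"]
    by (simp add: case_prod_unfold)
  also have "\<dots> = (\<Sum>u\<in>N. \<Sum>t\<in>D u. int (local_intersection f g (c + t *\<^sub>R ivec u)))"
    using fN fD by (simp add: sum.Sigma)
  also have "\<dots> = (\<Sum>u\<in>N. int (wt (face (supp g) (ivec u))) * (idot s0 u - hmin (supp f) u))"
  proof (rule sum.cong[OF refl])
    fix u assume u: "u \<in> N"
    have "(\<Sum>t\<in>D u. int (local_intersection f g (c + t *\<^sub>R ivec u))) =
        int (wt (face (supp g) (ivec u))) * (\<Sum>t\<in>D u. width (minimizers f (c + t *\<^sub>R ivec u)) u)"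
      by (simp add: sum_distrib_left loc[OF u])
    also have "(\<Sum>t\<in>D u. width (minimizers f (c + t *\<^sub>R ivec u)) u) = idot s0 u - hmin (supp f) u"
      using jumps_along_ray[OF assms(1,5)] fD[OF u] by (simp add: D_def)
    finally show "(\<Sum>t\<in>D u. int (local_intersection f g (c + t *\<^sub>R ivec u))) =
      int (wt (face (supp g) (ivec u))) * (idot s0 u - hmin (supp f) u)" .
  qed
  finally show ?thesis by (simp add: N_def)
qed

section \<open>Two fans in general position\<close>

definition det_real :: "int \<times> int \<Rightarrow> real \<times> real \<Rightarrow> real" where
  "det_real u v = of_int (fst u) * snd v - of_int (snd u) * fst v"

lemma det_real_scale [simp]: "det_real u (t *\<^sub>R ivec u) = 0"
  by (simp add: det_real_def ivec_def)

lemma normals_primitive: "u \<in> normals S \<Longrightarrow> primitive u"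
  by (simp add: normals_def)

text \<open>If the displacement of the apices is parallel to no ray, neither apex lies on the other
  curve, and parallel rays do not meet. Every common point is then a proper crossing of two rays,
  determined by their directions.\<close>

lemma transversal_fans:
  assumes S: "finite S" "S \<noteq> {}" and T: "finite T" "T \<noteq> {}"
    and "c \<noteq> c'" and gen: "\<And>u. u \<in> normals S \<union> normals T \<Longrightarrow> det_real u (c' - c) \<noteq> 0"
  shows "transversal (fan S c) (fan T c')"
proof -
  define V where "V = trop_curve (fan S c) \<inter> trop_curve (fan T c')"
  have mins: "minimizers (fan S c) p = face S (p - c)" "minimizers (fan T c') p = face T (p - c')" for p
    using is_fanD[OF is_fan_fan[OF S]] is_fanD[OF is_fan_fan[OF T]] by simp_all
  have pt: "\<exists>u\<in>normals S. \<exists>v\<in>normals T. \<exists>t s.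
      p = c + t *\<^sub>R ivec u \<and> p = c' + s *\<^sub>R ivec v \<and>
      minimizers (fan S c) p = face S (ivec u) \<and> minimizers (fan T c') p = face T (ivec v)"
    if "p \<in> V" for p
  proof -
    have card: "card (face S (p - c)) \<ge> 2" "card (face T (p - c')) \<ge> 2"
      using that by (auto simp: V_def trop_curve_def mins)
    have "p - c \<noteq> 0"
    proof
      assume "p - c = 0"
      then have pc: "p = c" by simp
      then have "p - c' \<noteq> 0" using \<open>c \<noteq> c'\<close> by simp
      then obtain v s where "v \<in> normals T" "p - c' = s *\<^sub>R ivec v"
        using ray_of_face[OF card(2)] by metis
      then have "c' - c = (- s) *\<^sub>R ivec v" using pc by (simp add: algebra_simps)
      then show False using gen[of v] \<open>v \<in> normals T\<close> det_real_scale by (metis UnI2)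
    qed
    then obtain u t where u: "u \<in> normals S" "p - c = t *\<^sub>R ivec u" "face S (p - c) = face S (ivec u)"
      using ray_of_face[OF card(1)] by metis
    have "p - c' \<noteq> 0"
    proof
      assume "p - c' = 0"
      then have "c' - c = t *\<^sub>R ivec u" using u(2) by simp
      then show False using gen[of u] u(1) det_real_scale by (metis UnI1)
    qed
    then obtain v s where v: "v \<in> normals T" "p - c' = s *\<^sub>R ivec v" "face T (p - c') = face T (ivec v)"
      using ray_of_face[OF card(2)] by metis
    have "p = c + t *\<^sub>R ivec u" "p = c' + s *\<^sub>R ivec v"
      using u(2) v(2) by (metis add.commute diff_add_cancel)+
    then show ?thesis using u v mins by blast
  qed
  \<comment> \<open>Cramer's rule for the crossing of the lines through \<open>c\<close> along
    \<open>u\<close> and through \<open>c'\<close> along \<open>v\<close>.\<close>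
  define q where "q = (\<lambda>(u, v). c' + (- det_real u (c' - c) / det2 u v) *\<^sub>R ivec v)"
  have "V \<subseteq> q ` (normals S \<times> normals T)"
  proof
    fix p assume "p \<in> V"
    then obtain u v t s where u: "u \<in> normals S" "v \<in> normals T"
      "p = c + t *\<^sub>R ivec u" "p = c' + s *\<^sub>R ivec v" using pt by blast
    have "c' - c = t *\<^sub>R ivec u - s *\<^sub>R ivec v" using u(3,4) by (simp add: algebra_simps)
    then have eq: "det_real u (c' - c) = - s * det2 u v"
      by (simp add: det_real_def det2_def ivec_def algebra_simps)
    then have "real_of_int (det2 u v) \<noteq> 0" using gen[of u] u(1) by auto
    then have "s = - det_real u (c' - c) / det2 u v" using eq by (simp add: field_simps)
    then have "p = q (u, v)" using u(4) by (simp add: q_def)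
    then show "p \<in> q ` (normals S \<times> normals T)" using u by blast
  qed
  then have "finite V"
    using finite_normals S(1) T(1) by (meson finite_SigmaI finite_imageI finite_subset)
  moreover have "(\<exists>u. orth (minimizers (fan S c) p) u) \<and> (\<exists>v. orth (minimizers (fan T c') p) v)"
    if p: "p \<in> V" for p
  proof -
    obtain u v where u: "u \<in> normals S" "minimizers (fan S c) p = face S (ivec u)"
      and v: "v \<in> normals T" "minimizers (fan T c') p = face T (ivec v)"
      using pt[OF p] by blast
    have "orth (minimizers (fan S c) p) u" "orth (minimizers (fan T c') p) v"
      using orth_face[OF normals_primitive[OF u(1)]] orth_face[OF normals_primitive[OF v(1)]]
      by (simp_all add: u(2) v(2))
    then show ?thesis by blast
  qed
  ultimately show ?thesis using S T by (simp add: transversal_iff V_def)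
qed

text \<open>Some \<open>(1, t)\<close> with \<open>t > 0\<close> avoids the finitely many slopes of
  \<open>N\<close>. The positive coordinates serve the choice of sides in the proof of
  balancing.\<close>

lemma generic_vector:
  assumes "finite N" "\<And>u. u \<in> N \<Longrightarrow> primitive u"
  obtains v where "fst v > 0" "snd v > 0" "\<And>u. u \<in> N \<Longrightarrow> det_real u v \<noteq> 0"
proof -
  have "infinite ({0<..} - (\<lambda>u. real_of_int (snd u) / real_of_int (fst u)) ` N)"
    using assms(1) by (simp add: Diff_infinite_finite infinite_Ioi)
  then have "{0<..} - (\<lambda>u. real_of_int (snd u) / real_of_int (fst u)) ` N \<noteq> {}"
    by (metis finite.emptyI)
  then obtain t where t: "t > 0" "t \<notin> (\<lambda>u. real_of_int (snd u) / real_of_int (fst u)) ` N"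
    by blast
  have "det_real u (1, t) \<noteq> 0" if u: "u \<in> N" for u
  proof (cases "fst u = 0")
    case True
    then show ?thesis using assms(2)[OF u] by (auto simp: det_real_def primitive_def)
  next
    case False
    then have "det_real u (1, t) = 0 \<Longrightarrow> t = real_of_int (snd u) / real_of_int (fst u)"
      by (simp add: det_real_def field_simps)
    then show ?thesis using t(2) u by blast
  qed
  then show thesis using that[of "(1, t)"] t(1) by simp
qed

section \<open>Balancing\<close>

lemma normals_segment:
  assumes "primitive e"
  shows "normals {0, e} = {(- snd e, fst e), (snd e, - fst e)}"
    and "u \<in> normals {0, e} \<Longrightarrow> face {0, e} (ivec u) = {0, e}"
proof -
  have e0: "e \<noteq> 0" using assms by (auto simp: primitive_def)
  have face_sub: "face {0, e} d \<subseteq> {0, e}" for d unfolding face_def by blast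
  have full: "face {0, e} (ivec u) = {0, e} \<longleftrightarrow> idot e u = 0" for u
  proof -
    have "face {0, e} (ivec u) = {0, e} \<longleftrightarrow> 0 \<in> face {0, e} (ivec u) \<and> e \<in> face {0, e} (ivec u)"
      using face_sub[of "ivec u"] by blast
    also have "\<dots> \<longleftrightarrow> idot 0 u \<le> idot e u \<and> idot e u \<le> idot 0 u"
      by (simp add: face_def ivec_inner_ivec)
    also have "\<dots> \<longleftrightarrow> idot e u = 0" by (auto simp: idot_def)
    finally show ?thesis .
  qed
  show face: "face {0, e} (ivec u) = {0, e}" if "u \<in> normals {0, e}" for u
  proof -
    have "card {0, e} \<le> card (face {0, e} (ivec u))" using that e0 by (simp add: normals_def)
    then show ?thesis using card_seteq[OF _ face_sub] by simp
  qed
  have pe: "primitive (- snd e, fst e)" "primitive (snd e, - fst e)"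
    using assms by (simp_all add: primitive_def coprime_commute)
  show "normals {0, e} = {(- snd e, fst e), (snd e, - fst e)}"
  proof (intro subset_antisym subsetI)
    fix u assume u: "u \<in> normals {0, e}"
    then have "idot e u = 0" using face full by blast
    then have "det2 (- snd e, fst e) u = 0" by (simp add: det2_def idot_def)
    then have "u = (- snd e, fst e) \<or> u = - (- snd e, fst e)"
      by (rule primitive_parallel[OF pe(1) normals_primitive[OF u]])
    then show "u \<in> {(- snd e, fst e), (snd e, - fst e)}" by auto
  next
    fix u assume u: "u \<in> {(- snd e, fst e), (snd e, - fst e)}"
    then have "idot e u = 0" by (auto simp: idot_def)
    then have "face {0, e} (ivec u) = {0, e}" using full by blast
    then show "u \<in> normals {0, e}" using u pe e0 by (auto simp: normals_def)
  qed
qed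

lemma face_zero: "face S 0 = S"
  by (auto simp: face_def)

text \<open>Intersect the fan of \<open>T\<close> with the line dual to the segment from \<open>0\<close> to \<open>e\<close>. As the line is
  balanced, its intersection number with the fan does not depend on the side on which the vertex
  of the fan lies.\<close>

lemma balanced_primitive:
  assumes T: "finite T" "T \<noteq> {}" and e: "primitive e"
    and pos: "\<And>v. fst v > 0 \<Longrightarrow> snd v > 0 \<Longrightarrow> ivec e \<bullet> v > 0"
  shows "(\<Sum>u\<in>normals T. int (wt (face T (ivec u))) * idot e u) = 0"
proof -
  define w where "w u = int (wt (face T (ivec u)))" for u
  define S where "S = {0, e}"
  have S: "finite S" "S \<noteq> {}" by (simp_all add: S_def)
  have e0: "e \<noteq> 0" using e by (auto simp: primitive_def)
  have fin: "finite (normals S \<union> normals T)" using finite_normals S T by simp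
  have prim: "primitive u" if "u \<in> normals S \<union> normals T" for u
    using that normals_primitive by blast
  obtain v where v: "fst v > 0" "snd v > 0"
      "\<And>u. u \<in> normals S \<union> normals T \<Longrightarrow> det_real u v \<noteq> 0"
    by (rule generic_vector[OF fin prim]) (assumption, rule that)
  have v0: "v \<noteq> 0" using v(1) by auto
  have det_minus: "det_real u (- x) = - det_real u x" for u x by (simp add: det_real_def)
  \<comment> \<open>The count along the two opposite rays of the line: the terms in
    \<open>s0\<close> cancel, so \<open>K\<close> does not depend on the apex
    \<open>c\<close>.\<close>
  define K where "K = int (wt S) * (- hmin T (- snd e, fst e) - hmin T (snd e, - fst e))"
  have count: "(\<Sum>u\<in>normals T. w u * (idot s u - hmin S u)) = K"
    if c: "c = v \<or> c = - v" and s: "face S c = {s}" for c s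
  proof -
    have gen: "det_real u c \<noteq> 0" "det_real u (- c) \<noteq> 0" if "u \<in> normals S \<union> normals T" for u
      using c v(3)[OF that] by (auto simp: det_minus)
    have c0: "0 \<noteq> c" using c v0 by auto
    have tr: "transversal (fan S 0) (fan T c)"
      using transversal_fans[OF S T c0] gen by simp
    have sub: "minimizers (fan S 0) c = {s}"
      using is_fanD[OF is_fan_fan[OF S], of 0] s by simp
    have "0 \<notin> trop_curve (fan T c)"
    proof
      assume "0 \<in> trop_curve (fan T c)"
      then have "card (face T (- c)) \<ge> 2"
        using is_fanD[OF is_fan_fan[OF T], of c] by (simp add: trop_curve_def)
      then obtain u t where "u \<in> normals T" "- c = t *\<^sub>R ivec u"
        using ray_of_face[of T "- c"] c0 by (metis neg_equal_0_iff_equal)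
      then show False using gen(2)[of u] det_real_scale by (metis UnI2)
    qed
    then obtain s0 where s0: "minimizers (fan T c) 0 = {s0}"
      using card_minimizers_eq_1 T is_trop_poly_fan by blast
    have "int (intersection_number (fan T c) (fan S 0)) =
        (\<Sum>u\<in>normals S. int (wt (face S (ivec u))) * (idot s0 u - hmin T u))"
      using intersection_number_fan_unbalanced[OF _ _ _ is_fan_fan[OF S] s0] tr S T
      by (simp add: transversal_commute)
    also have "\<dots> = (\<Sum>u\<in>normals S. int (wt S) * (idot s0 u - hmin T u))"
      using normals_segment(2)[OF e] by (intro sum.cong) (simp_all add: S_def)
    also have "\<dots> = K"
    proof -
      have "(- snd e, fst e) \<noteq> (snd e, - fst e)" using e by (auto simp: primitive_def)
      then have "(\<Sum>u\<in>normals S. int (wt S) * (idot s0 u - hmin T u)) =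
          int (wt S) * (idot s0 (- snd e, fst e) - hmin T (- snd e, fst e)) +
          int (wt S) * (idot s0 (snd e, - fst e) - hmin T (snd e, - fst e))"
        unfolding S_def normals_segment(1)[OF e] by (subst sum.insert) simp_all
      then show ?thesis by (simp add: K_def idot_def algebra_simps)
    qed
    \<comment> \<open>The same number, counted along the rays of the fan of \<open>T\<close>,
      involves the minimizer \<open>s\<close> at its apex.\<close>
    finally show ?thesis
      using intersection_number_fan_unbalanced[OF _ _ tr is_fan_fan[OF T] sub] S T
      by (simp add: w_def intersection_number_commute)
  qed
  \<comment> \<open>On the side of \<open>v\<close> the line polynomial is minimized by
    \<open>0\<close>, on the opposite side by \<open>e\<close>. Equating the two counts leaves the
    balancing sum for \<open>e\<close>.\<close>
  have "ivec e \<bullet> v > 0" using pos v by blast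
  moreover have "ivec 0 = 0" by (simp add: ivec_def zero_prod_def)
  ultimately have "face S v = {0}" "face S (- v) = {e}"
    by (auto simp: face_def S_def)
  then have "(\<Sum>u\<in>normals T. w u * (idot 0 u - hmin S u)) = (\<Sum>u\<in>normals T. w u * (idot e u - hmin S u))"
    using count[of v 0] count[of "- v" e] by simp
  then show ?thesis by (simp add: idot_def right_diff_distrib sum_subtractf w_def sum_negf)
qed

text \<open>Both unit vectors have positive product with vectors in the open positive quadrant, so
  \<open>balanced_primitive\<close> covers them; the rest is linearity in \<open>z\<close>.\<close>

lemma balanced:
  assumes "finite T" "T \<noteq> {}"
  shows "(\<Sum>u\<in>normals T. int (wt (face T (ivec u))) * idot z u) = 0"
proof -
  have 1: "(\<Sum>u\<in>normals T. int (wt (face T (ivec u))) * idot (1, 0) u) = 0"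
    by (rule balanced_primitive[OF assms]) (simp_all add: primitive_def ivec_def inner_prod_def)
  have 2: "(\<Sum>u\<in>normals T. int (wt (face T (ivec u))) * idot (0, 1) u) = 0"
    by (rule balanced_primitive[OF assms]) (simp_all add: primitive_def ivec_def inner_prod_def)
  have "idot z u = fst z * idot (1, 0) u + snd z * idot (0, 1) u" for u
    by (simp add: idot_def)
  then have "(\<Sum>u\<in>normals T. int (wt (face T (ivec u))) * idot z u) =
      fst z * (\<Sum>u\<in>normals T. int (wt (face T (ivec u))) * idot (1, 0) u) +
      snd z * (\<Sum>u\<in>normals T. int (wt (face T (ivec u))) * idot (0, 1) u)"
    by (simp add: sum_distrib_left sum.distrib algebra_simps)
  then show ?thesis by (simp add: 1 2)
qed

subsection \<open>Mixed volumes\<close>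

text \<open>The mixed volume of the convex hulls of \<open>T\<close> and \<open>S\<close>, normalised so that \<open>mixed T T\<close> is twice
  the area.\<close>

definition mixed :: "(int \<times> int) set \<Rightarrow> (int \<times> int) set \<Rightarrow> int" where
  "mixed T S = - (\<Sum>u\<in>normals T. int (wt (face T (ivec u))) * hmin S u)"

text \<open>If the apex is off the curve of \<open>f\<close>, balancing removes the terms in
  \<open>s0\<close> from the unbalanced formula. The remaining work is for an apex on the curve of
  \<open>f\<close>.\<close>

lemma intersection_number_fan:
  assumes "is_trop_poly f" "is_trop_poly g" "transversal f g" "is_fan g c"
  shows "int (intersection_number f g) = mixed (supp g) (supp f)"
proof -
  have T: "finite (supp g)" "supp g \<noteq> {}" using assms(2) by (auto simp: is_trop_poly_def)
  have off: ?thesis if fan: "is_fan g c'" and c': "c' \<notin> trop_curve f" for c'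
  proof -
    obtain s0 where "minimizers f c' = {s0}" using card_minimizers_eq_1 assms(1) c' by blast
    then show ?thesis
      using intersection_number_fan_unbalanced[OF assms(1-3) fan] balanced[OF T, of s0]
      by (simp add: mixed_def right_diff_distrib sum_subtractf)
  qed
  show ?thesis
  proof (cases "c \<in> trop_curve f")
    case False
    then show ?thesis using off assms(4) by blast
  next
    case c: True
    show ?thesis
    proof (cases "c \<in> trop_curve g")
      case False
      \<comment> \<open>At the apex all terms of \<open>g\<close> tie. If the apex is not on the
        curve, the support is a single point and both sides vanish.\<close>
      then have "card (supp g) < 2"
        using is_fanD[OF assms(4), of c] by (simp add: trop_curve_def face_zero)
      moreover have "card (face (supp g) d) \<le> card (supp g)" for d
        using T(1) by (intro card_mono) (auto simp: face_def)
      ultimately have "card (face (supp g) d) < 2" for d by (meson le_less_trans)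
      then have "\<not> 2 \<le> card (face (supp g) d)" for d by (simp add: not_le)
      then have "normals (supp g) = {}" "trop_curve g = {}"
        by (simp_all add: normals_def trop_curve_def is_fanD[OF assms(4)])
      then show ?thesis by (simp add: mixed_def intersection_number_def)
    next
      case True
      \<comment> \<open>Transversality at the apex forces the whole support of \<open>g\<close> to
        be collinear, so the curve of \<open>g\<close> is a line and any of its points can serve as
        apex.\<close>
      then obtain u where u: "orth (minimizers g c) u"
        using assms(1-3) c transversal_iff by blast
      then have orth: "orth (supp g) u" by (simp add: is_fanD[OF assms(4)] face_zero)
      then have u0: "ivec u \<noteq> 0" using primitive_nonzero by (auto simp: orth_def)
      have const: "ivec s \<bullet> (t *\<^sub>R ivec u) = ivec s' \<bullet> (t *\<^sub>R ivec u)"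
        if "s \<in> supp g" "s' \<in> supp g" for s s' t
        using orthD[OF orth that] by (simp add: ivec_inner_ivec)
      have shift: "face (supp g) (p - t *\<^sub>R ivec u) = face (supp g) p" for p t
        unfolding face_def inner_diff_right
      proof (intro Collect_cong conj_cong[OF refl] ball_cong[OF refl])
        fix s s' assume "s \<in> supp g" "s' \<in> supp g"
        then show "ivec s \<bullet> p - ivec s \<bullet> t *\<^sub>R ivec u \<le> ivec s' \<bullet> p - ivec s' \<bullet> t *\<^sub>R ivec u \<longleftrightarrow>
            ivec s \<bullet> p \<le> ivec s' \<bullet> p"
          by (subst const[of s s' t]) auto
      qed
      have on_g: "c + t *\<^sub>R ivec u \<in> trop_curve g" for t
      proof -
        have "minimizers g (c + t *\<^sub>R ivec u) = face (supp g) (0 - (- t) *\<^sub>R ivec u)"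
          by (simp add: is_fanD[OF assms(4)])
        also have "\<dots> = minimizers g c"
          unfolding shift by (simp add: is_fanD[OF assms(4)])
        finally show ?thesis using True by (simp add: trop_curve_def)
      qed
      \<comment> \<open>The line meets the curve of \<open>f\<close> in finitely many points only,
        so some point on it is off that curve.\<close>
      have "infinite (range (\<lambda>t::real. c + t *\<^sub>R ivec u))"
        using u0 by (subst finite_image_iff) (auto simp: inj_on_def infinite_UNIV_char_0)
      moreover have "finite (trop_curve f \<inter> trop_curve g)"
        using assms(3) by (simp add: transversal_def)
      ultimately obtain t where t: "c + t *\<^sub>R ivec u \<notin> trop_curve f"
        using on_g by (meson IntI finite_subset image_subsetI)
      have "is_fan g (c + t *\<^sub>R ivec u)"
        unfolding is_fan_def
        by (simp only: is_fanD[OF assms(4)] diff_diff_eq[symmetric] shift) simp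
      then show ?thesis using off t by blast
    qed
  qed
qed

section \<open>Symmetry and additivity of the mixed volume\<close>

lemma transversal_fan_exists:
  assumes "finite S" "S \<noteq> {}" "finite T" "T \<noteq> {}"
  obtains v where "transversal (fan S c) (fan T (c + v))"
proof -
  have fin: "finite (normals S \<union> normals T)" using finite_normals assms by simp
  have prim: "primitive u" if "u \<in> normals S \<union> normals T" for u
    using that normals_primitive by blast
  obtain v where v: "fst v > 0" "snd v > 0"
      "\<And>u. u \<in> normals S \<union> normals T \<Longrightarrow> det_real u v \<noteq> 0"
    by (rule generic_vector[OF fin prim]) (assumption, rule that)
  have "c \<noteq> c + v" using v(1) by auto
  then have "transversal (fan S c) (fan T (c + v))"
    using v(3) by (intro transversal_fans assms) simp_all
  then show thesis by (rule that)
qed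

text \<open>For two fans in general position, either one can play the role of \<open>g\<close> in
  \<open>intersection_number_fan\<close>, while the intersection number is symmetric.\<close>

lemma mixed_commute:
  assumes "finite S" "S \<noteq> {}" "finite T" "T \<noteq> {}"
  shows "mixed S T = mixed T S"
proof -
  obtain v where tr: "transversal (fan S 0) (fan T (0 + v))"
    using transversal_fan_exists[OF assms] .
  have "int (intersection_number (fan S 0) (fan T (0 + v))) = mixed T S"
    using intersection_number_fan[OF _ _ tr is_fan_fan] assms by simp
  moreover have "int (intersection_number (fan T (0 + v)) (fan S 0)) = mixed S T"
    using intersection_number_fan[OF _ _ _ is_fan_fan] tr assms
    by (simp add: transversal_commute)
  ultimately show ?thesis by (simp add: intersection_number_commute)
qed

text \<open>Translation only moves the apex, and the mixed volume does not see the apex; hence all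
  transversal translates give the same number.\<close>

lemma self_intersection_fan:
  assumes "finite S" "S \<noteq> {}" "mixed S S = int n"
  shows "has_self_intersection_number (fan S c) n"
  unfolding has_self_intersection_number_def
proof (intro conjI allI impI)
  obtain v where "transversal (fan S c) (fan S (c + v))"
    using transversal_fan_exists assms(1,2) by metis
  then have "transversal (fan S c) (translate (- v) (fan S c))" by (simp add: translate_fan)
  then show "\<exists>v. transversal (fan S c) (translate v (fan S c))" ..
next
  fix v assume "transversal (fan S c) (translate v (fan S c))"
  then have tr: "transversal (fan S c) (fan S (c - v))" by (simp add: translate_fan)
  have "int (intersection_number (fan S c) (fan S (c - v))) = mixed S S"
    using intersection_number_fan[OF _ _ tr is_fan_fan] assms(1,2) by simp
  then show "intersection_number (fan S c) (translate v (fan S c)) = n"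
    using assms(3) by (simp add: translate_fan)
qed

definition msum :: "(int \<times> int) set \<Rightarrow> (int \<times> int) set \<Rightarrow> (int \<times> int) set" where
  "msum S T = (\<lambda>(s, t). s + t) ` (S \<times> T)"

lemma hmin_msum:
  assumes "finite S" "S \<noteq> {}" "finite T" "T \<noteq> {}"
  shows "hmin (msum S T) u = hmin S u + hmin T u"
proof -
  have min: "hmin X u \<in> (\<lambda>s. idot s u) ` X" "\<And>s. s \<in> X \<Longrightarrow> hmin X u \<le> idot s u"
    if "finite X" "X \<noteq> {}" for X
    using that by (auto simp: hmin_def intro!: Min_in)
  obtain s where s: "s \<in> S" "hmin S u = idot s u" using min(1)[OF assms(1,2)] by blast
  obtain t where t: "t \<in> T" "hmin T u = idot t u" using min(1)[OF assms(3,4)] by blast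
  show ?thesis
    unfolding hmin_def[of "msum S T"]
  proof (rule Min_eqI)
    show "finite ((\<lambda>s. idot s u) ` msum S T)" using assms by (simp add: msum_def)
    have "s + t \<in> msum S T" using s t by (force simp: msum_def)
    then show "hmin S u + hmin T u \<in> (\<lambda>s. idot s u) ` msum S T"
      using s t by (auto simp: idot_add_left intro!: image_eqI)
    fix y assume "y \<in> (\<lambda>s. idot s u) ` msum S T"
    then obtain a b where "a \<in> S" "b \<in> T" "y = idot (a + b) u" by (auto simp: msum_def)
    then show "hmin S u + hmin T u \<le> y"
      using min(2)[OF assms(1,2), of a] min(2)[OF assms(3,4), of b] by (simp add: idot_add_left)
  qed
qed

text \<open>The sum in \<open>mixed\<close> runs over the normals of the first argument, so
  additivity is immediate in the second; \<open>mixed_commute\<close> carries it over to the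
  first.\<close>

lemma mixed_msum_right:
  assumes "finite S" "S \<noteq> {}" "finite T" "T \<noteq> {}"
  shows "mixed R (msum S T) = mixed R S + mixed R T"
  by (simp add: mixed_def hmin_msum[OF assms] distrib_left sum.distrib)

text \<open>For the empty set this relies on truncated subtraction in
  \<open>lattice_length\<close>.\<close>

lemma wt_eq_0:
  assumes "finite m" "card m < 2"
  shows "wt m = 0"
proof -
  have "m = {} \<or> (\<exists>s. m = {s})"
  proof -
    have "card m = 0 \<or> card m = 1" using assms(2) by linarith
    then show ?thesis using assms(1) card_1_singletonE by (metis card_0_eq)
  qed
  moreover have "{z. ivec z = ivec s} = {s}" for s by (auto simp: ivec_def)
  ultimately show ?thesis by (auto simp: wt_def lattice_length_def)
qed

text \<open>Directions that are not normals have faces of weight 0, so an upper bound for the set of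
  normals suffices to compute \<open>mixed\<close>.\<close>

lemma mixed_superset:
  assumes "finite T" "finite U" "normals T \<subseteq> U" "\<And>u. u \<in> U \<Longrightarrow> primitive u"
  shows "mixed T S = - (\<Sum>u\<in>U. int (wt (face T (ivec u))) * hmin S u)"
proof -
  have "wt (face T (ivec u)) = 0" if "u \<in> U - normals T" for u
  proof (rule wt_eq_0)
    show "finite (face T (ivec u))" using assms(1) by (simp add: face_def)
    show "card (face T (ivec u)) < 2" using that assms(4)[of u] by (auto simp: normals_def)
  qed
  then show ?thesis
    unfolding mixed_def using assms(2,3) by (subst sum.mono_neutral_left) auto
qed

subsection \<open>Realising the triples\<close>

text \<open>The parallel sides at heights 0 and 1 have lengths \<open>b - i\<close> and
  \<open>j\<close>. The cases \<open>i = b\<close> and \<open>j = 0\<close> are allowed, so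
  triangles and segments are included.\<close>

definition trapezoid :: "int \<Rightarrow> int \<Rightarrow> int \<Rightarrow> (int \<times> int) set" where
  "trapezoid b i j = {(i, 0), (b, 0), (0, 1), (j, 1)}"

lemma finite_trapezoid [simp]: "finite (trapezoid b i j)" "trapezoid b i j \<noteq> {}"
  by (simp_all add: trapezoid_def)

lemma face_ivec: "face S (ivec u) = {s \<in> S. \<forall>s'\<in>S. idot s u \<le> idot s' u}"
  by (simp add: face_def ivec_inner_ivec)

lemma hmin_trapezoid:
  "hmin (trapezoid b i j) u = min (min (i * fst u) (b * fst u)) (snd u + min 0 (j * fst u))"
  by (simp add: hmin_def trapezoid_def idot_def)

lemma face_trapezoid:
  assumes "0 \<le> i" "i \<le> b" "0 \<le> j" "j \<le> b"
  shows "face (trapezoid b i j) (ivec (0, 1)) = {(i, 0), (b, 0)}"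
    and "face (trapezoid b i j) (ivec (0, -1)) = {(0, 1), (j, 1)}"
    and "face (trapezoid b i j) (ivec (1, i)) = {(i, 0), (0, 1)}"
    and "face (trapezoid b i j) (ivec (-1, j - b)) = {(b, 0), (j, 1)}"
  using assms by (auto simp: face_ivec trapezoid_def idot_def)

text \<open>A tie between points of equal height makes the normal vertical. A tie between different
  heights makes the first coordinate of the normal a unit, whose sign selects the left or the right
  side.\<close>

lemma normals_trapezoid:
  assumes "0 \<le> i" "i \<le> b" "0 \<le> j" "j \<le> b"
  shows "normals (trapezoid b i j) \<subseteq> {(0, 1), (0, -1), (1, i), (-1, j - b)}"
proof
  fix u assume u: "u \<in> normals (trapezoid b i j)"
  obtain x y where xy: "u = (x, y)" by fastforce
  have cop: "coprime x y" using normals_primitive[OF u] by (simp add: primitive_def xy)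
  obtain s s' where s: "s \<in> face (trapezoid b i j) (ivec u)" "s' \<in> face (trapezoid b i j) (ivec u)" "s \<noteq> s'"
    using u obtain_two unfolding normals_def by blast
  have mem: "t \<in> trapezoid b i j" and le: "t' \<in> trapezoid b i j \<Longrightarrow> idot t u \<le> idot t' u"
    if "t \<in> face (trapezoid b i j) (ivec u)" for t t'
    using that by (simp_all add: face_ivec)
  have unit: "x = 1 \<or> x = -1" if "y = k * x" for k
  proof -
    have "is_unit x" using cop that by (metis coprime_common_divisor dvd_refl dvd_triv_right)
    then show ?thesis by (simp add: zdvd1_eq) linarith
  qed
  have horizontal: "u \<in> {(0, 1), (0, -1)}" if "x = 0"
  proof -
    have "is_unit y" using cop that by simp
    then have "y = 1 \<or> y = -1" by (simp add: zdvd1_eq) linarith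
    then show ?thesis using that xy by auto
  qed
  have slanted: "u \<in> {(1, i), (-1, j - b)}"
    if t: "t \<in> face (trapezoid b i j) (ivec u)" "t' \<in> face (trapezoid b i j) (ivec u)"
      "snd t = 0" "snd t' = 1" for t t'
  proof -
    obtain p q where pq: "t = (p, 0)" "t' = (q, 1)" using t(3,4) by (metis prod.collapse)
    have p: "p = i \<or> p = b" and q: "q = 0 \<or> q = j"
      using mem[OF t(1)] mem[OF t(2)] by (auto simp: pq trapezoid_def)
    have min: "p * x \<le> i * x" "p * x \<le> b * x" "q * x \<le> 0" "q * x \<le> j * x"
      using le[OF t(1), of "(i, 0)"] le[OF t(1), of "(b, 0)"]
        le[OF t(2), of "(0, 1)"] le[OF t(2), of "(j, 1)"]
      by (simp_all add: trapezoid_def idot_def pq xy)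
    have "idot t u = idot t' u"
      using le[OF t(1) mem[OF t(2)]] le[OF t(2) mem[OF t(1)]] by (rule antisym)
    then have y: "y = (p - q) * x" by (simp add: pq xy idot_def algebra_simps)
    then consider "x = 1" | "x = -1" using unit by blast
    then show ?thesis
    proof cases
      case 1
      then have "p = i" "q = 0" using min p q assms by auto
      then show ?thesis using 1 y xy by simp
    next
      case 2
      then have "p = b" "q = j" using min p q assms by auto
      then show ?thesis using 2 y xy by simp
    qed
  qed
  have "idot s u = idot s' u"
    using le[OF s(1) mem[OF s(2)]] le[OF s(2) mem[OF s(1)]] by (rule antisym)
  then have eq: "(fst s - fst s') * x = (snd s' - snd s) * y"
    by (simp add: xy idot_def algebra_simps)
  have "snd s = 0 \<or> snd s = 1" "snd s' = 0 \<or> snd s' = 1"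
    using mem[OF s(1)] mem[OF s(2)] by (auto simp: trapezoid_def)
  then consider "snd s = snd s'" | "snd s = 0" "snd s' = 1" | "snd s = 1" "snd s' = 0" by fastforce
  then show "u \<in> {(0, 1), (0, -1), (1, i), (-1, j - b)}"
  proof cases
    case 1
    then have "x = 0" using eq s(3) by (simp add: prod_eq_iff)
    then show ?thesis using horizontal by blast
  next
    case 2
    then show ?thesis using slanted s by blast
  next
    case 3
    then show ?thesis using slanted s by blast
  qed
qed

text \<open>A direction \<open>d\<close> complementing \<open>u\<close> to a lattice basis reads off
  the weight directly.\<close>

lemma wt_segment:
  assumes "primitive u" "idot s u = idot t u" "\<bar>det2 u d\<bar> = 1"
  shows "int (wt {s, t}) = \<bar>idot s d - idot t d\<bar>"
proof -
  have "orth {s, t} u" using assms(1,2) by (auto simp: orth_def)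
  then have "int (wt {s, t}) * \<bar>det2 u d\<bar> = width {s, t} d" by (intro wt_mult_det2) auto
  then show ?thesis using assms(3) by (simp add: width_def max_def min_def)
qed

text \<open>The slanted sides have lattice length 1 because the height is 1. Where a parallel side
  degenerates to a point, its weight is 0 and the formula persists.\<close>

lemma mixed_trapezoid:
  assumes "0 \<le> i" "i \<le> b" "0 \<le> j" "j \<le> b"
  shows "mixed (trapezoid b i j) S =
    - ((b - i) * hmin S (0, 1) + j * hmin S (0, -1) + hmin S (1, i) + hmin S (-1, j - b))"
proof -
  have w: "int (wt {(i, 0), (b, 0)}) = b - i" "int (wt {(0, 1), (j, 1)}) = j"
    "int (wt {(i, 0), (0, 1)}) = 1" "int (wt {(b, 0), (j, 1)}) = 1"
    using assms wt_segment[of "(0, 1)" "(i, 0)" "(b, 0)" "(1, 0)"]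
      wt_segment[of "(0, 1)" "(0, 1)" "(j, 1)" "(1, 0)"]
      wt_segment[of "(1, i)" "(i, 0)" "(0, 1)" "(0, 1)"]
      wt_segment[of "(-1, j - b)" "(b, 0)" "(j, 1)" "(0, 1)"]
    by (simp_all add: primitive_def idot_def det2_def)
  have "mixed (trapezoid b i j) S = - (\<Sum>u\<in>{(0, 1), (0, -1), (1, i), (-1, j - b)}.
      int (wt (face (trapezoid b i j) (ivec u))) * hmin S u)"
    using normals_trapezoid[OF assms] by (intro mixed_superset) (auto simp: primitive_def)
  then show ?thesis by (simp add: face_trapezoid[OF assms] w)
qed

section \<open>Descent on the triples\<close>

definition realisable :: "int \<Rightarrow> int \<Rightarrow> int \<Rightarrow> bool" where
  "realisable A B C \<longleftrightarrow> (\<exists>S T. finite S \<and> S \<noteq> {} \<and> finite T \<and> T \<noteq> {} \<and>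
     mixed S S = A \<and> mixed S T = B \<and> mixed T T = C)"

lemma realisableI:
  "finite S \<Longrightarrow> S \<noteq> {} \<Longrightarrow> finite T \<Longrightarrow> T \<noteq> {} \<Longrightarrow>
    mixed S S = A \<Longrightarrow> mixed S T = B \<Longrightarrow> mixed T T = C \<Longrightarrow> realisable A B C"
  unfolding realisable_def by blast

lemma realisable_commute: "realisable A B C \<Longrightarrow> realisable C B A"
  unfolding realisable_def using mixed_commute by metis

text \<open>Replacing \<open>T\<close> by \<open>S + T\<close> acts on the triple by
  bilinearity.\<close>

lemma realisable_add:
  assumes "realisable A B C"
  shows "realisable A (A + B) (A + 2 * B + C)"
proof -
  obtain S T where S: "finite S" "S \<noteq> {}" and T: "finite T" "T \<noteq> {}"
    and m: "mixed S S = A" "mixed S T = B" "mixed T T = C"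
    using assms unfolding realisable_def by blast
  have ST: "finite (msum S T)" "msum S T \<noteq> {}" using S T by (simp_all add: msum_def)
  have "mixed S (msum S T) = A + B" by (simp add: mixed_msum_right S T m)
  moreover have "mixed T (msum S T) = B + C"
    by (simp add: mixed_msum_right S T m mixed_commute[OF T S])
  then have "mixed (msum S T) (msum S T) = A + 2 * B + C"
    using mixed_commute[OF ST S] mixed_commute[OF ST T] \<open>mixed S (msum S T) = A + B\<close>
    by (simp add: mixed_msum_right S T)
  ultimately show ?thesis using m(1) by (intro realisableI[OF S ST])
qed

text \<open>The triangle with base \<open>A\<close> has twice the area \<open>A\<close>. Cutting or
  extending the triangle with base \<open>B\<close> to a trapezoid adjusts twice its area from
  \<open>B\<close> to \<open>C\<close>; the mixed volume remains \<open>B\<close> as long as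
  \<open>j + A \<le> B\<close>, which is what \<open>A + C \<le> 2 * B\<close> provides.\<close>

lemma realisable_trapezoids:
  assumes "0 \<le> A" "A \<le> B" "0 \<le> C" "A + C \<le> 2 * B"
  shows "realisable A B C"
proof -
  \<comment> \<open>At most one of \<open>i\<close> and \<open>j\<close> is nonzero: the bottom side
    is shortened if \<open>C < B\<close>, the top side is lengthened if
    \<open>C > B\<close>.\<close>
  define i where "i = max 0 (B - C)"
  define j where "j = max 0 (C - B)"
  have ij: "0 \<le> i" "i \<le> B" "0 \<le> j" "j \<le> B" "j + A \<le> B" "B + j - i = C"
    using assms by (auto simp: i_def j_def)
  have "mixed (trapezoid A 0 0) (trapezoid A 0 0) = A"
    using assms by (simp add: mixed_trapezoid hmin_trapezoid)
  moreover have "mixed (trapezoid A 0 0) (trapezoid B i j) = B"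
    using assms ij by (simp add: mixed_trapezoid hmin_trapezoid)
  moreover have "mixed (trapezoid B i j) (trapezoid B i j) = C"
    using ij by (simp add: mixed_trapezoid hmin_trapezoid)
  ultimately show ?thesis by (rule realisableI[OF finite_trapezoid finite_trapezoid])
qed

lemma realisable:
  assumes "0 \<le> A" "0 \<le> B" "0 \<le> C" "A * C \<le> B\<^sup>2"
  shows "realisable A B C"
  using assms
proof (induction "nat (A + B + C)" arbitrary: A B C rule: less_induct)
  case less
  \<comment> \<open>Stated for \<open>a\<close> and \<open>c\<close> with \<open>B\<close> fixed, so
    that it applies to \<open>(A, C)\<close> as well as to \<open>(C, A)\<close>.\<close>
  have step: "realisable a B c"
    if "a \<le> c" "0 \<le> a" "a * c \<le> B\<^sup>2" "a + B + c = A + B + C" for a c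
  proof -
    have "a\<^sup>2 \<le> a * c" using that by (simp add: power2_eq_square mult_left_mono)
    then have "a\<^sup>2 \<le> B\<^sup>2" using that by linarith
    then have "a \<le> B" using less.prems(2) power2_le_imp_le by blast
    show ?thesis
    proof (cases "a + c \<le> 2 * B")
      case True
      then show ?thesis using realisable_trapezoids that \<open>a \<le> B\<close> by simp
    next
      case far: False
      show ?thesis
      \<comment> \<open>The descent lowers the sum of the triple by \<open>2 * B\<close>, so
        \<open>B = 0\<close> is separate; there \<open>a = 0\<close>, and a point together with a
        triangle does it.\<close>
      proof (cases "B = 0")
        case True
        have "mixed {0} S = 0" for S
        proof -
          have "card (face {0} d) \<le> card {0 :: int \<times> int}" for d
            by (intro card_mono) (auto simp: face_def)
          then have "\<not> 2 \<le> card (face {0 :: int \<times> int} d)" for d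
            by (metis One_nat_def Suc_1 card.empty card.insert empty_iff finite.emptyI not_less_eq_eq)
          then have "normals {0} = {}" by (simp add: normals_def)
          then show ?thesis by (simp add: mixed_def)
        qed
        moreover have "mixed (trapezoid c 0 0) (trapezoid c 0 0) = c"
          using that by (simp add: mixed_trapezoid hmin_trapezoid)
        moreover have "a = 0" using True \<open>a \<le> B\<close> that by simp
        ultimately show ?thesis
          using True by (intro realisableI[OF _ _ finite_trapezoid(1)[of c 0 0] finite_trapezoid(2), of "{0}"]) auto
      next
        case False
        \<comment> \<open>The entries stay nonnegative because \<open>a \<le> B\<close> and
          \<open>a + c > 2 * B\<close>; the difference
          \<open>(B - a)\<^sup>2 - a * (c - 2 * B + a)\<close> equals
          \<open>B\<^sup>2 - a * c\<close>.\<close>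
        have "realisable a (B - a) (c - 2 * B + a)"
        proof (rule less.hyps)
          show "nat (a + (B - a) + (c - 2 * B + a)) < nat (A + B + C)"
            using that less.prems False far \<open>a \<le> B\<close> by linarith
          show "a * (c - 2 * B + a) \<le> (B - a)\<^sup>2"
            using that(3) by (simp add: power2_eq_square algebra_simps)
        qed (use that far \<open>a \<le> B\<close> in auto)
        from realisable_add[OF this] show ?thesis by (simp add: algebra_simps)
      qed
    qed
  qed
  show ?case
  proof (cases "A \<le> C")
    case True
    then show ?thesis using step less.prems by simp
  next
    case False
    then have "realisable C B A" using step[of C A] less.prems by (simp add: mult.commute)
    then show ?thesis by (rule realisable_commute)
  qed
qed

theorem theorem5p2:
  fixes A B C :: nat
  assumes "A * C \<le> B ^ 2"
  shows "\<exists>f g. is_trop_poly f \<and> is_trop_poly g \<and>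
           has_self_intersection_number f A \<and>
           transversal f g \<and> intersection_number f g = B \<and>
           has_self_intersection_number g C"
proof -
  have "int A * int C \<le> (int B)\<^sup>2" using assms by (metis of_nat_le_iff of_nat_mult of_nat_power)
  then obtain S T where S: "finite S" "S \<noteq> {}" and T: "finite T" "T \<noteq> {}"
    and m: "mixed S S = int A" "mixed S T = int B" "mixed T T = int C"
    using realisable[of "int A" "int B" "int C"] unfolding realisable_def by auto
  \<comment> \<open>Shifting one apex makes the curves transversal and leaves both self-intersection
    numbers unchanged.\<close>
  obtain v where v: "transversal (fan S 0) (fan T (0 + v))"
    using transversal_fan_exists[OF S T] .
  have "int (intersection_number (fan S 0) (fan T (0 + v))) = mixed T S"
    using intersection_number_fan[OF _ _ v is_fan_fan] S T by simp
  then have "intersection_number (fan S 0) (fan T (0 + v)) = B"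
    using m(2) mixed_commute[OF S T] by simp
  then show ?thesis
    using self_intersection_fan[OF S m(1), of 0] self_intersection_fan[OF T m(3), of "0 + v"] v S T
    by (intro exI[of _ "fan S 0"] exI[of _ "fan T (0 + v)"]) simp
qed

end
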